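(* Let $g=\frac{\sqrt5-1}{2}$. For every $\alpha\in[1-g,g]$ the Wilton function $W_\alpha$ belongs to $\mathrm{BMO}$.
   Context: For $\alpha\in(0,1]$ put $\bar\alpha=\max(\alpha,1-\alpha)$ and let $[\cdot]$ denote the integer part (floor). The $\alpha$-continued fraction map is $A_\alpha:[0,\bar\alpha]\to[0,\bar\alpha]$, $A_\alpha(0)=0$, $A_\alpha(x)=\left|\frac1x-\left[\frac1x+1-\alpha\right]\right|$ for $x\neq0$. For $x\in\mathbb R\setminus\mathbb Q$ let $x_{\alpha,0}=|x-[x+1-\bar\alpha]|$, $x_{\alpha,n}=A_\alpha^n(x_{\alpha,0})$, $\beta_{\alpha,-1}(x)=1$, and $\beta_{\alpha,n}(x)=x_{\alpha,0}x_{\alpha,1}\cdots x_{\alpha,n}$ for $n\ge0$. The Wilton function is $$W_\alpha(x)=\sum_{j=0}^\infty(-1)^j\beta_{\alpha,j-1}(x)\log\frac{1}{x_{\alpha,j}},$$ which is defined for almost every $x\in\mathbb R$, is $1$-periodic and locally integrable. A locally integrable function $f$ on $\mathbb R$ is in $\mathrm{BMO}$ (bounded mean oscillation) if $\sup_I\frac1{|I|}\int_I|f-f_I|\,dx<\infty$, where $I$ ranges over all bounded intervals of positive length and $f_I=\frac1{|I|}\int_I f\,dx$. *)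

theory Defs
  imports "HOL-Analysis.Analysis"
begin

definition alpha_bar :: "real \<Rightarrow> real" where
  "alpha_bar \<alpha> = max \<alpha> (1 - \<alpha>)"

(* Total on the reals; only its restriction to [0, alpha_bar \<alpha>], which it maps into itself,
   is relevant. *)
definition cf_map :: "real \<Rightarrow> real \<Rightarrow> real" where
  "cf_map \<alpha> x = (if x = 0 then 0 else \<bar>1 / x - of_int \<lfloor>1 / x + 1 - \<alpha>\<rfloor>\<bar>)"

(* The initial point uses alpha_bar, whereas the map itself uses \<alpha>. *)
definition cf_orbit :: "real \<Rightarrow> real \<Rightarrow> nat \<Rightarrow> real" where
  "cf_orbit \<alpha> x n = (cf_map \<alpha> ^^ n) \<bar>x - of_int \<lfloor>x + 1 - alpha_bar \<alpha>\<rfloor>\<bar>"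

(* The index is shifted by one with respect to the usual notation:
   cf_beta \<alpha> x n is x_0 x_1 ... x_(n-1), that is beta_(\<alpha>, n-1)(x), and equals 1 for n = 0. *)
definition cf_beta :: "real \<Rightarrow> real \<Rightarrow> nat \<Rightarrow> real" where
  "cf_beta \<alpha> x n = (\<Prod>i<n. cf_orbit \<alpha> x i)"

definition wilton_term :: "real \<Rightarrow> real \<Rightarrow> nat \<Rightarrow> real" where
  "wilton_term \<alpha> x j = (- 1) ^ j * cf_beta \<alpha> x j * ln (1 / cf_orbit \<alpha> x j)"

definition wilton_defined :: "real \<Rightarrow> real \<Rightarrow> bool" where
  "wilton_defined \<alpha> x \<longleftrightarrow> x \<notin> \<rat> \<and> summable (wilton_term \<alpha> x)"

(* The value 0 outside the domain of definition is a convention. *)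
definition wilton :: "real \<Rightarrow> real \<Rightarrow> real" where
  "wilton \<alpha> x = (if wilton_defined \<alpha> x then (\<Sum>j. wilton_term \<alpha> x j) else 0)"

definition locally_integrable :: "(real \<Rightarrow> real) \<Rightarrow> bool" where
  "locally_integrable f \<longleftrightarrow> (\<forall>K. compact K \<longrightarrow> set_integrable lebesgue K f)"

definition mean_on :: "real set \<Rightarrow> (real \<Rightarrow> real) \<Rightarrow> real" where
  "mean_on I f = (LINT x:I|lebesgue. f x) / measure lebesgue I"

definition BMO :: "(real \<Rightarrow> real) set" where
  "BMO = {f. locally_integrable f \<and>
     bdd_above {mean_on I (\<lambda>x. \<bar>f x - mean_on I f\<bar>) | I.
       is_interval I \<and> bounded I \<and> measure lebesgue I > 0}}"

end

theory Submission
  imports Defs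
begin

text \<open>Write \<open>W\<close> for the Wilton function of the parameter 1/2.  It is 1-periodic and even, and on
  \<open>(0, 1/2)\<close> it satisfies \<open>W(x) = - log x - x W(1/x)\<close> exactly, wherever its series converges.  The theorem
  follows from two facts: \<open>W\<close> has bounded mean oscillation, and for every admissible \<open>\<alpha>\<close> the function
  \<open>W\<^sub>\<alpha>\<close> differs from \<open>W\<close> by a bounded function almost everywhere.

  Convergence.  The substitution \<open>v = 1 / x\<close> turns the weight \<open>x\<close> into \<open>v\<^sup>-\<^sup>3\<close>, and the sum of \<open>v\<^sup>-\<^sup>3\<close>
  over the relevant translates of a point is less than 1/2.  Hence \<open>h \<mapsto> x h(A\<^sub>\<alpha>(x))\<close> contracts
  the integral over the domain of the map (\<open>cf_transfer_contraction\<close>), and for integrable \<open>h\<close> the series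
  \<open>\<Sum> \<beta>\<^sub>n\<^sub>-\<^sub>1(x) h(x\<^sub>n)\<close> converges almost everywhere to an integrable function.  With \<open>h = log (1/x)\<close> this
  gives \<open>W\<close>, and with \<open>h = W\<close> it shows that the remainders in the comparison below vanish in the limit.

  Oscillation of \<open>W\<close>.  For an interval \<open>I\<close> in \<open>(0, 1/2)\<close> whose inverse \<open>J\<close> is short,
  the functional equation bounds the oscillation on \<open>I\<close> by 3/4 of the oscillation on \<open>J\<close> plus a constant (\<open>osc_le_inversion\<close>); if \<open>J\<close> is
  long, integrability alone bounds it (\<open>integral_far\<close>).  Intervals that contain an integer fold to
  \<open>[0, t]\<close>, where the inverse is unbounded; intervals that contain a half-integer fold to
  \<open>[1/2 - t, 1/2]\<close>, whose inverse has the left end 2, an integer.  Since \<open>J\<close> is at least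
  four times as long as \<open>I\<close>, finitely many steps reach one of these cases.

  Comparison.  The points of an \<open>\<alpha>\<close>-orbit lie in \<open>[0, g]\<close>, so the functional equation for \<open>W\<close> has to be
  extended from \<open>(0, 1/2)\<close> to \<open>(0, g]\<close>, up to a bounded defect.  Beyond 1/2 the paths
  from \<open>x\<close> through \<open>1 / x\<close> and through \<open>1 - x\<close> meet again after the same number of inversions, so the
  signs agree and the unbounded terms cancel (\<open>wilton_defect_step\<close>).  Iterating the equation along the \<open>\<alpha>\<close>-orbit yields the series
  of \<open>W\<^sub>\<alpha>\<close> and an absolutely convergent series of defects with bounded sum.\<close>

section \<open>Integrals over intervals: translation, inversion, periodicity\<close>

lemma nn_integral_shift:
  fixes f :: "real \<Rightarrow> ennreal"
  assumes [measurable]: "f \<in> borel_measurable borel"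
  shows "(\<integral>\<^sup>+x\<in>{a..b}. f (x + c) \<partial>lborel) = (\<integral>\<^sup>+x\<in>{a + c..b + c}. f x \<partial>lborel)"
proof -
  have "(\<integral>\<^sup>+x\<in>{a + c..b + c}. f x \<partial>lborel)
      = ennreal \<bar>1\<bar> * (\<integral>\<^sup>+x. f (c + 1 * x) * indicator {a + c..b + c} (c + 1 * x) \<partial>lborel)"
    by (rule nn_integral_real_affine) auto
  also have "\<dots> = (\<integral>\<^sup>+x\<in>{a..b}. f (x + c) \<partial>lborel)"
    by (auto intro!: nn_integral_cong simp: indicator_def add.commute)
  finally show ?thesis by simp
qed

lemma nn_integral_reflect:
  fixes f :: "real \<Rightarrow> ennreal"
  assumes [measurable]: "f \<in> borel_measurable borel"
  shows "(\<integral>\<^sup>+x\<in>{a..b}. f (c - x) \<partial>lborel) = (\<integral>\<^sup>+x\<in>{c - b..c - a}. f x \<partial>lborel)"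
proof -
  have "(\<integral>\<^sup>+x\<in>{c - b..c - a}. f x \<partial>lborel)
      = ennreal \<bar>- 1\<bar> * (\<integral>\<^sup>+x. f (c + (- 1) * x) * indicator {c - b..c - a} (c + (- 1) * x) \<partial>lborel)"
    by (rule nn_integral_real_affine) auto
  also have "\<dots> = (\<integral>\<^sup>+x\<in>{a..b}. f (c - x) \<partial>lborel)"
    by (auto intro!: nn_integral_cong simp: indicator_def)
  finally show ?thesis by simp
qed

lemma nn_integral_inversion:
  fixes f :: "real \<Rightarrow> ennreal"
  assumes [measurable]: "f \<in> borel_measurable borel" and "0 < a" "a < b"
  shows "(\<integral>\<^sup>+x\<in>{a..b}. f x \<partial>lborel)
       = (\<integral>\<^sup>+v\<in>{1 / b..1 / a}. f (1 / v) * ennreal (1 / v\<^sup>2) \<partial>lborel)"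
proof -
  have lt: "- (1 / a) < - (1 / b)" using assms by (simp add: field_simps)
  have "(\<integral>\<^sup>+x\<in>{a..b}. f x \<partial>lborel)
      = (\<integral>\<^sup>+x. f x * indicator {- 1 / (- (1 / a))..- 1 / (- (1 / b))} x \<partial>lborel)"
    using assms by simp
  also have "\<dots> = (\<integral>\<^sup>+u. f (- 1 / u) * ennreal (1 / u\<^sup>2) * indicator {- (1 / a)..- (1 / b)} u \<partial>lborel)"
  proof (rule nn_integral_substitution_aux[where g = "\<lambda>u. - 1 / u"])
    fix u assume u: "u \<in> {- (1 / a)..- (1 / b)}"
    have "1 / b > 0" using assms by simp
    then have "u \<noteq> 0" using u by auto
    then show "((\<lambda>u. - 1 / u) has_real_derivative 1 / u\<^sup>2) (at u)"
      by (auto intro!: derivative_eq_intros simp: power2_eq_square)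
  next
    have "1 / b > 0" using assms by simp
    then show "continuous_on {- (1 / a)..- (1 / b)} (\<lambda>u. 1 / u\<^sup>2)"
      by (intro continuous_intros) auto
  qed (use lt in auto)
  also have "\<dots> = (\<integral>\<^sup>+u\<in>{0 - 1 / a..0 - 1 / b}. f (- 1 / u) * ennreal (1 / u\<^sup>2) \<partial>lborel)"
    by simp
  also have "\<dots> = (\<integral>\<^sup>+v\<in>{1 / b..1 / a}. f (- 1 / (0 - v)) * ennreal (1 / (0 - v)\<^sup>2) \<partial>lborel)"
    by (rule nn_integral_reflect[symmetric]) measurable
  finally show ?thesis by simp
qed

lemma nn_integral_split:
  fixes f :: "real \<Rightarrow> ennreal"
  assumes [measurable]: "f \<in> borel_measurable borel" and "a \<le> c" "c \<le> b"
  shows "(\<integral>\<^sup>+x\<in>{a..b}. f x \<partial>lborel)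
       = (\<integral>\<^sup>+x\<in>{a..c}. f x \<partial>lborel) + (\<integral>\<^sup>+x\<in>{c..b}. f x \<partial>lborel)"
proof -
  have "AE x in lborel. x \<noteq> c" by (rule AE_lborel_singleton)
  then have "(\<integral>\<^sup>+x\<in>{a..b}. f x \<partial>lborel)
      = (\<integral>\<^sup>+x. f x * indicator {a..c} x + f x * indicator {c..b} x \<partial>lborel)"
    by (intro nn_integral_cong_AE) (use assms in \<open>auto simp: indicator_def\<close>)
  also have "\<dots> = (\<integral>\<^sup>+x\<in>{a..c}. f x \<partial>lborel) + (\<integral>\<^sup>+x\<in>{c..b}. f x \<partial>lborel)"
    by (rule nn_integral_add) measurable
  finally show ?thesis .
qed

lemma nn_integral_mono_set:
  fixes f :: "real \<Rightarrow> ennreal"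
  assumes "A \<subseteq> B"
  shows "(\<integral>\<^sup>+x\<in>A. f x \<partial>lborel) \<le> (\<integral>\<^sup>+x\<in>B. f x \<partial>lborel)"
  by (intro nn_integral_mono) (use assms in \<open>auto simp: indicator_def\<close>)

lemma nn_integral_mono_on:
  fixes f g :: "real \<Rightarrow> ennreal"
  assumes "\<And>x. x \<in> A \<Longrightarrow> f x \<le> g x"
  shows "(\<integral>\<^sup>+x\<in>A. f x \<partial>lborel) \<le> (\<integral>\<^sup>+x\<in>A. g x \<partial>lborel)"
  by (intro nn_integral_mono) (use assms in \<open>auto simp: indicator_def\<close>)

lemma nn_integral_const_Icc:
  fixes a b k :: real
  assumes "a \<le> b" "0 \<le> k"
  shows "(\<integral>\<^sup>+x\<in>{a..b}. ennreal k \<partial>lborel) = ennreal (k * (b - a))"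
  using assms by (subst nn_integral_cmult) (auto simp: ennreal_mult)

lemma nn_integral_Icc_from_zero:
  fixes f :: "real \<Rightarrow> ennreal"
  assumes [measurable]: "f \<in> borel_measurable borel" and "0 < t"
    and le: "\<And>e. 0 < e \<Longrightarrow> e < t \<Longrightarrow> (\<integral>\<^sup>+x\<in>{e..t}. f x \<partial>lborel) \<le> K"
  shows "(\<integral>\<^sup>+x\<in>{0..t}. f x \<partial>lborel) \<le> K"
proof -
  define e where "e n = t * inverse (real (Suc (Suc n)))" for n
  have e: "0 < e n" "e n < t" for n
    using \<open>0 < t\<close> mult_pos_pos[of t "1 + real n"] by (auto simp: e_def field_simps)
  have dec: "e n \<le> e m" if "m \<le> n" for m n
    using that \<open>0 < t\<close> by (auto simp: e_def intro!: mult_left_mono le_imp_inverse_le)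
  have lim: "e \<longlonglongrightarrow> 0"
    unfolding e_def by (intro tendsto_mult_right_zero LIMSEQ_Suc LIMSEQ_inverse_real_of_nat)
  have Sup: "(SUP n. f x * indicator {e n..t} x) = f x * indicator {0<..t} x" for x
  proof (cases "x \<in> {0<..t}")
    case True
    then have "\<forall>\<^sub>F n in sequentially. e n < x"
      using lim by (intro order_tendstoD) auto
    then obtain n where n: "e n < x" by (auto simp: eventually_sequentially)
    show ?thesis
    proof (rule antisym)
      show "(SUP n. f x * indicator {e n..t} x) \<le> f x * indicator {0<..t} x"
        using True by (auto intro!: SUP_least simp: indicator_def)
      show "f x * indicator {0<..t} x \<le> (SUP n. f x * indicator {e n..t} x)"
        using True n by (intro SUP_upper2[of n]) (auto simp: indicator_def)
    qed
  next
    case False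
    then have "x \<notin> {e n..t}" for n using e(1)[of n] by auto
    then show ?thesis using False by simp
  qed
  have "AE x in lborel. x \<noteq> (0::real)" by (rule AE_lborel_singleton)
  then have "(\<integral>\<^sup>+x\<in>{0..t}. f x \<partial>lborel) = (\<integral>\<^sup>+x. (SUP n. f x * indicator {e n..t} x) \<partial>lborel)"
    unfolding Sup by (intro nn_integral_cong_AE) (auto simp: indicator_def)
  also have "\<dots> = (SUP n. (\<integral>\<^sup>+x\<in>{e n..t}. f x \<partial>lborel))"
    by (rule nn_integral_monotone_convergence_SUP)
      (use dec in \<open>fastforce simp: incseq_def le_fun_def indicator_def intro: order_trans\<close>)+
  also have "\<dots> \<le> K" using le e by (intro SUP_least) auto
  finally show ?thesis .
qed

lemma nn_integral_period:
  fixes H :: "real \<Rightarrow> ennreal"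
  assumes [measurable]: "H \<in> borel_measurable borel" and per: "\<And>x. H (x + 1) = H x"
  shows "(\<integral>\<^sup>+x\<in>{c..c + 1}. H x \<partial>lborel) = (\<integral>\<^sup>+x\<in>{0..1}. H x \<partial>lborel)"
proof -
  have pern: "H (x + real n) = H x" for x n
    by (induction n) (use per[of "x + real _"] in \<open>auto simp: add_ac\<close>)
  have peri: "H (x + of_int k) = H x" for x k
  proof (cases "k \<ge> 0")
    case True
    then show ?thesis using pern[of x "nat k"] by simp
  next
    case False
    then show ?thesis using pern[of "x + of_int k" "nat (- k)"] by simp
  qed
  define d where "d = frac c"
  have d: "0 \<le> d" "d \<le> 1" "c = d + of_int \<lfloor>c\<rfloor>"
    using frac_lt_1[of c] by (auto simp: d_def frac_def)
  have "(\<integral>\<^sup>+x\<in>{c..c + 1}. H x \<partial>lborel) = (\<integral>\<^sup>+x\<in>{d + of_int \<lfloor>c\<rfloor>..d + 1 + of_int \<lfloor>c\<rfloor>}. H x \<partial>lborel)"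
    using d(3) by (simp add: add_ac)
  also have "\<dots> = (\<integral>\<^sup>+x\<in>{d..d + 1}. H x \<partial>lborel)"
    by (subst nn_integral_shift[symmetric]) (auto simp: peri)
  also have "\<dots> = (\<integral>\<^sup>+x\<in>{d..1}. H x \<partial>lborel) + (\<integral>\<^sup>+x\<in>{0 + 1..d + 1}. H x \<partial>lborel)"
    using d by (subst nn_integral_split[of _ _ 1]) auto
  also have "(\<integral>\<^sup>+x\<in>{0 + 1..d + 1}. H x \<partial>lborel) = (\<integral>\<^sup>+x\<in>{0..d}. H x \<partial>lborel)"
    by (subst nn_integral_shift[symmetric]) (auto simp: per)
  also have "(\<integral>\<^sup>+x\<in>{d..1}. H x \<partial>lborel) + (\<integral>\<^sup>+x\<in>{0..d}. H x \<partial>lborel) = (\<integral>\<^sup>+x\<in>{0..1}. H x \<partial>lborel)"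
    using d by (subst nn_integral_split[of _ 0 d 1]) (auto simp: add_ac)
  finally show ?thesis .
qed

lemma nn_integral_log_Icc:
  fixes a b :: real
  assumes "0 < a" "a \<le> b"
  shows "(\<integral>\<^sup>+x\<in>{a..b}. ennreal (ln (b / x)) \<partial>lborel) \<le> ennreal (b - a)"
proof -
  have "(\<integral>\<^sup>+x\<in>{a..b}. ennreal (ln (b / x)) \<partial>lborel)
      = ennreal ((b * ln (b / b) + b) - (a * ln (b / a) + a))"
  proof (rule nn_integral_FTC_Icc)
    fix x assume x: "x \<in> {a..b}"
    then have "x > 0" "b > 0" using assms by auto
    then show "((\<lambda>x. x * ln (b / x) + x) has_real_derivative ln (b / x)) (at x)"
      by (auto intro!: derivative_eq_intros simp: field_simps)
    show "0 \<le> ln (b / x)" using x assms by (intro ln_ge_zero) auto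
  qed (use assms in auto)
  also have "\<dots> \<le> ennreal (b - a)"
    using assms by (intro ennreal_leI) auto
  finally show ?thesis .
qed

text \<open>The cubic weight that inversion produces is summable over unit intervals, with a telescoping
  majorant sharp enough to make the constant of the contraction below smaller than 1.\<close>

lemma sum_inverse_cubes_le:
  fixes A :: real
  assumes "A \<ge> 1"
  shows "(\<Sum>k<n. 1 / (A + real k)^3) \<le> (1 / (A - 1/2)\<^sup>2 - 1 / (A + real n - 1/2)\<^sup>2) / 2"
proof (induction n)
  case (Suc n)
  define v where "v = A + real n"
  have v: "v \<ge> 1" using assms by (simp add: v_def)
  have "v^2 - 1/4 > 0" using v one_le_power[of v 2] by linarith
  then have "1 / v^3 \<le> v / (v\<^sup>2 - 1/4)\<^sup>2"
    using v by (simp add: divide_simps) (simp add: power2_eq_square power3_eq_cube algebra_simps)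
  also have "\<dots> = (1 / (v - 1/2)\<^sup>2 - 1 / (v + 1/2)\<^sup>2) / 2"
  proof -
    have "v\<^sup>2 - 1/4 = (v - 1/2) * (v + 1/2)" by (simp add: power2_eq_square algebra_simps)
    then have 1: "(v\<^sup>2 - 1/4)\<^sup>2 = (v - 1/2)\<^sup>2 * (v + 1/2)\<^sup>2" by (simp add: power_mult_distrib)
    have "(v + 1/2)\<^sup>2 - (v - 1/2)\<^sup>2 = 2 * v" by (simp add: power2_eq_square algebra_simps)
    then show ?thesis unfolding 1 using v by (simp add: diff_frac_eq)
  qed
  finally show ?case using Suc by (simp add: v_def algebra_simps)
qed simp

lemma nn_integral_periodic_cubic_weight:
  fixes H :: "real \<Rightarrow> ennreal"
  assumes [measurable]: "H \<in> borel_measurable borel" and per: "\<And>x. H (x + 1) = H x" and "A \<ge> 1"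
  shows "(\<integral>\<^sup>+v\<in>{A..A + real n}. H v * ennreal (1 / v^3) \<partial>lborel)
      \<le> ennreal ((1 / (A - 1/2)\<^sup>2 - 1 / (A + real n - 1/2)\<^sup>2) / 2) * (\<integral>\<^sup>+x\<in>{0..1}. H x \<partial>lborel)"
proof -
  let ?L = "\<integral>\<^sup>+x\<in>{0..1}. H x \<partial>lborel"
  have "(\<integral>\<^sup>+v\<in>{A..A + real n}. H v * ennreal (1 / v^3) \<partial>lborel)
      \<le> ennreal (\<Sum>k<n. 1 / (A + real k)^3) * ?L"
  proof (induction n)
    case 0
    have "AE v in lborel. v \<noteq> A" by (rule AE_lborel_singleton)
    then have "(\<integral>\<^sup>+v\<in>{A..A + real 0}. H v * ennreal (1 / v^3) \<partial>lborel) = (\<integral>\<^sup>+v. 0 \<partial>(lborel :: real measure))"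
      by (intro nn_integral_cong_AE) (auto simp: indicator_def)
    then show ?case by simp
  next
    case (Suc n)
    let ?B = "A + real n"
    have pos: "0 < ?B" using assms by simp
    have "(\<integral>\<^sup>+v\<in>{?B..?B + 1}. H v * ennreal (1 / v^3) \<partial>lborel)
        \<le> (\<integral>\<^sup>+v\<in>{?B..?B + 1}. ennreal (1 / ?B^3) * H v \<partial>lborel)"
    proof (rule nn_integral_mono_on)
      fix v assume v: "v \<in> {?B..?B + 1}"
      then have "?B^3 \<le> v^3" using pos by (intro power_mono) auto
      then have "1 / v^3 \<le> 1 / ?B^3" using pos v by (intro divide_left_mono mult_pos_pos) auto
      then show "H v * ennreal (1 / v^3) \<le> ennreal (1 / ?B^3) * H v"
        by (simp add: mult.commute mult_left_mono ennreal_leI)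
    qed
    also have "\<dots> = ennreal (1 / ?B^3) * (\<integral>\<^sup>+v\<in>{?B..?B + 1}. H v \<partial>lborel)"
      unfolding mult.assoc by (rule nn_integral_cmult) measurable
    also have "(\<integral>\<^sup>+v\<in>{?B..?B + 1}. H v \<partial>lborel) = ?L"
      by (rule nn_integral_period) (auto simp: per)
    finally have last: "(\<integral>\<^sup>+v\<in>{?B..?B + 1}. H v * ennreal (1 / v^3) \<partial>lborel) \<le> ennreal (1 / ?B^3) * ?L" .
    have "(\<integral>\<^sup>+v\<in>{A..A + real (Suc n)}. H v * ennreal (1 / v^3) \<partial>lborel)
        = (\<integral>\<^sup>+v\<in>{A..?B}. H v * ennreal (1 / v^3) \<partial>lborel)
          + (\<integral>\<^sup>+v\<in>{?B..?B + 1}. H v * ennreal (1 / v^3) \<partial>lborel)"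
      by (subst nn_integral_split[of _ _ ?B]) (auto simp: add_ac)
    also have "\<dots> \<le> ennreal (\<Sum>k<n. 1 / (A + real k)^3) * ?L + ennreal (1 / ?B^3) * ?L"
      by (rule add_mono[OF Suc last])
    also have "\<dots> = ennreal (\<Sum>k<Suc n. 1 / (A + real k)^3) * ?L"
      using assms pos by (simp add: distrib_right ennreal_plus sum_nonneg)
    finally show ?case .
  qed
  also have "\<dots> \<le> ennreal ((1 / (A - 1/2)\<^sup>2 - 1 / (A + real n - 1/2)\<^sup>2) / 2) * ?L"
    using sum_inverse_cubes_le[OF \<open>A \<ge> 1\<close>, of n] by (intro mult_right_mono ennreal_leI) auto
  finally show ?thesis .
qed

section \<open>The folded orbit and the contraction in mean\<close>

text \<open>The distance-like folding of the line onto the interval from 0 to the maximum of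
  \<open>a\<close> and \<open>1 - a\<close>: the absolute value of the representative of \<open>v\<close> modulo 1 in \<open>[a - 1, a)\<close>.  The
  continued fraction map is the folding of \<open>1 / x\<close>; the initial point is a folding of \<open>x\<close>.\<close>

definition cf_fold :: "real \<Rightarrow> real \<Rightarrow> real" where
  "cf_fold a v = \<bar>v - of_int \<lfloor>v + 1 - a\<rfloor>\<bar>"

text \<open>The product of the first \<open>n\<close> points of the orbit of \<open>y\<close> under the map.\<close>

definition cf_prod :: "real \<Rightarrow> real \<Rightarrow> nat \<Rightarrow> real" where
  "cf_prod a y n = (\<Prod>i<n. (cf_map a ^^ i) y)"

lemma cf_map_eq_fold: "x \<noteq> 0 \<Longrightarrow> cf_map a x = cf_fold a (1 / x)"
  by (simp add: cf_map_def cf_fold_def)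

lemma cf_orbit_eq: "cf_orbit a x n = (cf_map a ^^ n) (cf_fold (alpha_bar a) x)"
  by (simp add: cf_orbit_def cf_fold_def)

lemma cf_beta_eq: "cf_beta a x n = cf_prod a (cf_fold (alpha_bar a) x) n"
  by (simp add: cf_beta_def cf_prod_def cf_orbit_eq)

lemma cf_prod_Suc_shift: "cf_prod a y (Suc n) = y * cf_prod a (cf_map a y) n"
  unfolding cf_prod_def by (subst prod.lessThan_Suc_shift) (simp add: funpow_swap1)

lemma alpha_bar_alpha_bar: "0 \<le> a \<Longrightarrow> a \<le> 1 \<Longrightarrow> alpha_bar (alpha_bar a) = alpha_bar a"
  by (auto simp: alpha_bar_def max_def)

lemma alpha_bar_ge_half: "1 / 2 \<le> alpha_bar a"
  by (auto simp: alpha_bar_def max_def)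

lemma cf_fold_periodic: "cf_fold a (v + of_int k) = cf_fold a v"
proof -
  have "v + of_int k + 1 - a = (v + 1 - a) + of_int k" by simp
  then have "\<lfloor>v + of_int k + 1 - a\<rfloor> = \<lfloor>v + 1 - a\<rfloor> + k" by (simp only: floor_add_int)
  then show ?thesis by (simp add: cf_fold_def)
qed

lemma cf_fold_nonneg: "0 \<le> cf_fold a v"
  by (simp add: cf_fold_def)

lemma cf_fold_le: "cf_fold a v \<le> alpha_bar a"
proof -
  have "v - of_int \<lfloor>v + 1 - a\<rfloor> < a" "a - 1 \<le> v - of_int \<lfloor>v + 1 - a\<rfloor>" by linarith+
  then show ?thesis by (auto simp: cf_fold_def alpha_bar_def)
qed

lemma cf_map_nonneg: "0 \<le> cf_map a x"
  by (simp add: cf_map_def)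

lemma cf_map_le: "cf_map a x \<le> alpha_bar a"
  using cf_fold_le[of a "1 / x"] alpha_bar_ge_half[of a] cf_map_eq_fold[of x a]
  by (cases "x = 0") (auto simp: cf_map_def)

lemma cf_orbit_bounds: 
  assumes "0 \<le> a" "a \<le> 1"
  shows "0 \<le> cf_orbit a x n" "cf_orbit a x n \<le> alpha_bar a"
proof -
  have "0 \<le> cf_orbit a x n \<and> cf_orbit a x n \<le> alpha_bar a"
    unfolding cf_orbit_eq
    by (cases n) (use cf_fold_le[of "alpha_bar a" x] assms in
      \<open>auto simp: cf_map_nonneg cf_map_le cf_fold_nonneg alpha_bar_alpha_bar\<close>)
  then show "0 \<le> cf_orbit a x n" "cf_orbit a x n \<le> alpha_bar a" by auto
qed

lemma cf_beta_nonneg: "0 \<le> a \<Longrightarrow> a \<le> 1 \<Longrightarrow> 0 \<le> cf_beta a x n"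
  unfolding cf_beta_def by (auto intro!: prod_nonneg cf_orbit_bounds)

lemma cf_fold_measurable [measurable]: "cf_fold a \<in> borel_measurable borel"
  unfolding cf_fold_def by measurable

lemma cf_map_measurable [measurable]: "cf_map a \<in> borel_measurable borel"
  unfolding cf_map_def by measurable

lemma cf_iterate_measurable [measurable]: "(\<lambda>x. (cf_map a ^^ n) x) \<in> borel_measurable borel"
proof (induction n)
  case (Suc n)
  then show ?case unfolding funpow.simps comp_def by measurable
qed (simp add: id_def)

lemma cf_prod_measurable [measurable]: "(\<lambda>y. cf_prod a y n) \<in> borel_measurable borel"
  unfolding cf_prod_def by measurable

lemma cf_orbit_measurable [measurable]: "(\<lambda>x. cf_orbit a x n) \<in> borel_measurable borel"
  unfolding cf_orbit_eq by measurable

lemma cf_beta_measurable [measurable]: "(\<lambda>x. cf_beta a x n) \<in> borel_measurable borel"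
  unfolding cf_beta_eq by measurable

lemma nn_integral_cf_fold_le:
  fixes h :: "real \<Rightarrow> ennreal"
  assumes [measurable]: "h \<in> borel_measurable borel" and "0 \<le> a" "a \<le> 1"
  shows "(\<integral>\<^sup>+v\<in>{0..1}. h (cf_fold a v) \<partial>lborel) \<le> 2 * (\<integral>\<^sup>+x\<in>{0..alpha_bar a}. h x \<partial>lborel)"
proof -
  let ?I = "\<integral>\<^sup>+x\<in>{0..alpha_bar a}. h x \<partial>lborel"
  have ne: "AE v in lborel. v \<noteq> a" by (rule AE_lborel_singleton)
  have eq: "cf_fold a v = \<bar>v\<bar>" if "a - 1 \<le> v" "v < a" for v
  proof -
    have "\<lfloor>v + 1 - a\<rfloor> = 0" using that by (simp add: floor_eq_iff)
    then show ?thesis by (simp add: cf_fold_def)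
  qed
  have "(\<integral>\<^sup>+v\<in>{0..1}. h (cf_fold a v) \<partial>lborel) = (\<integral>\<^sup>+v\<in>{a - 1..(a - 1) + 1}. h (cf_fold a v) \<partial>lborel)"
    by (rule nn_integral_period[symmetric]) (use cf_fold_periodic[of a _ 1] in auto)
  also have "\<dots> = (\<integral>\<^sup>+v\<in>{a - 1..a}. h \<bar>v\<bar> \<partial>lborel)"
    by (intro nn_integral_cong_AE, use ne in eventually_elim) (auto simp: indicator_def eq)
  also have "\<dots> = (\<integral>\<^sup>+v\<in>{a - 1..0}. h \<bar>v\<bar> \<partial>lborel) + (\<integral>\<^sup>+v\<in>{0..a}. h \<bar>v\<bar> \<partial>lborel)"
    using assms by (intro nn_integral_split) auto
  also have "(\<integral>\<^sup>+v\<in>{a - 1..0}. h \<bar>v\<bar> \<partial>lborel) = (\<integral>\<^sup>+v\<in>{a - 1..0}. h (0 - v) \<partial>lborel)"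
    by (intro nn_integral_cong) (auto simp: indicator_def)
  also have "\<dots> = (\<integral>\<^sup>+x\<in>{0..1 - a}. h x \<partial>lborel)"
    by (subst nn_integral_reflect) auto
  also have "(\<integral>\<^sup>+v\<in>{0..a}. h \<bar>v\<bar> \<partial>lborel) = (\<integral>\<^sup>+x\<in>{0..a}. h x \<partial>lborel)"
    by (intro nn_integral_cong) (auto simp: indicator_def)
  also have "(\<integral>\<^sup>+x\<in>{0..1 - a}. h x \<partial>lborel) + (\<integral>\<^sup>+x\<in>{0..a}. h x \<partial>lborel) \<le> ?I + ?I"
    by (intro add_mono nn_integral_mono_set) (auto simp: alpha_bar_def)
  finally show ?thesis by (simp add: mult_2)
qed

text \<open>The operator \<open>h \<mapsto> x h(A(x))\<close> contracts integrals: inversion turns the weight \<open>x\<close> into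
  \<open>v\<^sup>-\<^sup>3\<close>, and the integration runs over \<open>v \<ge> 8/5\<close>.\<close>

lemma cf_transfer_contraction:
  fixes h :: "real \<Rightarrow> ennreal"
  assumes [measurable]: "h \<in> borel_measurable borel" and a: "0 \<le> a" "a \<le> 1" "alpha_bar a \<le> 5 / 8"
  shows "(\<integral>\<^sup>+x\<in>{0..alpha_bar a}. ennreal x * h (cf_map a x) \<partial>lborel)
       \<le> ennreal (5 / 6) * (\<integral>\<^sup>+x\<in>{0..alpha_bar a}. h x \<partial>lborel)"
proof (rule nn_integral_Icc_from_zero)
  let ?b = "alpha_bar a"
  let ?I = "\<integral>\<^sup>+x\<in>{0..alpha_bar a}. h x \<partial>lborel"
  show "0 < ?b" using alpha_bar_ge_half[of a] by linarith
  fix e assume e: "0 < e" "e < ?b"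
  define A where "A = 1 / ?b"
  have A: "A \<ge> 8 / 5" using a \<open>0 < ?b\<close> by (simp add: A_def field_simps)
  define n where "n = nat \<lceil>1 / e - A\<rceil>"
  have n: "1 / e \<le> A + real n" unfolding n_def by linarith
  have "(\<integral>\<^sup>+x\<in>{e..?b}. ennreal x * h (cf_map a x) \<partial>lborel)
      = (\<integral>\<^sup>+v\<in>{A..1 / e}. ennreal (1 / v) * h (cf_map a (1 / v)) * ennreal (1 / v\<^sup>2) \<partial>lborel)"
    unfolding A_def by (rule nn_integral_inversion) (use e in auto)
  also have "\<dots> = (\<integral>\<^sup>+v\<in>{A..1 / e}. h (cf_fold a v) * ennreal (1 / v^3) \<partial>lborel)"
  proof (intro nn_integral_cong)
    fix v
    show "ennreal (1 / v) * h (cf_map a (1 / v)) * ennreal (1 / v\<^sup>2) * indicator {A..1 / e} v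
        = h (cf_fold a v) * ennreal (1 / v^3) * indicator {A..1 / e} v"
    proof (cases "v \<in> {A..1 / e}")
      case True
      then have v: "v > 0" using A by auto
      have "ennreal (1 / v) * ennreal (1 / v\<^sup>2) = ennreal (1 / v^3)"
        using v by (simp add: ennreal_mult[symmetric] power2_eq_square power3_eq_cube)
      moreover have "cf_map a (1 / v) = cf_fold a v" using v by (simp add: cf_map_eq_fold)
      moreover have "ennreal (1 / v) * h (cf_map a (1 / v)) * ennreal (1 / v\<^sup>2)
          = h (cf_map a (1 / v)) * (ennreal (1 / v) * ennreal (1 / v\<^sup>2))"
        by (simp only: mult_ac)
      ultimately show ?thesis by simp
    qed simp
  qed
  also have "\<dots> \<le> (\<integral>\<^sup>+v\<in>{A..A + real n}. h (cf_fold a v) * ennreal (1 / v^3) \<partial>lborel)"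
    by (rule nn_integral_mono_set) (use n in auto)
  also have "\<dots> \<le> ennreal ((1 / (A - 1/2)\<^sup>2 - 1 / (A + real n - 1/2)\<^sup>2) / 2)
      * (\<integral>\<^sup>+v\<in>{0..1}. h (cf_fold a v) \<partial>lborel)"
    by (rule nn_integral_periodic_cubic_weight) (use A cf_fold_periodic[of a _ 1] in auto)
  also have "\<dots> \<le> ennreal (5 / 12) * (2 * ?I)"
  proof (intro mult_mono ennreal_leI)
    have "(11 / 10)\<^sup>2 \<le> (A - 1/2)\<^sup>2" using A by (intro power_mono) auto
    then have "1 / (A - 1/2)\<^sup>2 \<le> 1 / (11 / 10)\<^sup>2" using A by (intro divide_left_mono) auto
    then have le: "1 / (A - 1/2)\<^sup>2 \<le> 5 / 6" by (simp add: power2_eq_square)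
    have half: "(p - q) / 2 \<le> 5 / 12" if "p \<le> 5 / 6" "0 \<le> q" for p q :: real
      using that by simp
    show "(1 / (A - 1/2)\<^sup>2 - 1 / (A + real n - 1/2)\<^sup>2) / 2 \<le> 5 / 12"
      by (rule half) (use le in simp_all)
  qed (use a in \<open>auto intro!: nn_integral_cf_fold_le\<close>)
  also have "\<dots> = (ennreal (5 / 12) * ennreal 2) * ?I" by (simp add: mult.assoc)
  also have "ennreal (5 / 12) * ennreal 2 = ennreal (5 / 6)"
    by (subst ennreal_mult[symmetric]) auto
  finally show "(\<integral>\<^sup>+x\<in>{e..?b}. ennreal x * h (cf_map a x) \<partial>lborel) \<le> ennreal (5 / 6) * ?I" .
qed measurable

lemma nn_integral_cf_iterate_le:
  fixes h :: "real \<Rightarrow> ennreal"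
  assumes "h \<in> borel_measurable borel" and a: "0 \<le> a" "a \<le> 1" "alpha_bar a \<le> 5 / 8"
  shows "(\<integral>\<^sup>+y\<in>{0..alpha_bar a}. ennreal (cf_prod a y n) * h ((cf_map a ^^ n) y) \<partial>lborel)
       \<le> ennreal ((5 / 6)^n) * (\<integral>\<^sup>+x\<in>{0..alpha_bar a}. h x \<partial>lborel)"
proof (induction n)
  case 0
  then show ?case by (simp add: cf_prod_def)
next
  case (Suc n)
  note assms(1) [measurable]
  let ?I = "\<integral>\<^sup>+x\<in>{0..alpha_bar a}. h x \<partial>lborel"
  let ?h = "\<lambda>y. ennreal (cf_prod a y n) * h ((cf_map a ^^ n) y)"
  have "(\<integral>\<^sup>+y\<in>{0..alpha_bar a}. ennreal (cf_prod a y (Suc n)) * h ((cf_map a ^^ Suc n) y) \<partial>lborel)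
      = (\<integral>\<^sup>+y\<in>{0..alpha_bar a}. ennreal y * ?h (cf_map a y) \<partial>lborel)"
  proof (intro nn_integral_cong)
    fix y
    have "ennreal (cf_prod a y (Suc n)) = ennreal y * ennreal (cf_prod a (cf_map a y) n)" if "y \<ge> 0"
      unfolding cf_prod_Suc_shift using that by (rule ennreal_mult')
    moreover have "(cf_map a ^^ Suc n) y = (cf_map a ^^ n) (cf_map a y)"
      by (simp add: funpow_swap1)
    ultimately show "ennreal (cf_prod a y (Suc n)) * h ((cf_map a ^^ Suc n) y) * indicator {0..alpha_bar a} y
      = ennreal y * ?h (cf_map a y) * indicator {0..alpha_bar a} y"
      by (cases "y \<in> {0..alpha_bar a}") (auto simp: mult.assoc)
  qed
  also have "\<dots> \<le> ennreal (5 / 6) * (\<integral>\<^sup>+y\<in>{0..alpha_bar a}. ?h y \<partial>lborel)"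
    by (rule cf_transfer_contraction) (use a in auto)
  also have "\<dots> \<le> ennreal (5 / 6) * (ennreal ((5 / 6)^n) * ?I)"
    by (intro mult_left_mono Suc) auto
  also have "\<dots> = ennreal ((5 / 6)^Suc n) * ?I"
    by (simp only: mult.assoc[symmetric] power_Suc, subst ennreal_mult[symmetric]) auto
  finally show ?case .
qed

text \<open>The orbit series of an integrable function, weighted by the products \<open>\<beta>\<close>, is integrable over a
  period, and so converges almost everywhere.\<close>

lemma nn_integral_cf_series_finite:
  fixes h :: "real \<Rightarrow> real"
  assumes [measurable]: "h \<in> borel_measurable borel" and a: "0 \<le> a" "a \<le> 1" "alpha_bar a \<le> 5 / 8"
    and fin: "(\<integral>\<^sup>+x\<in>{0..alpha_bar a}. ennreal \<bar>h x\<bar> \<partial>lborel) < \<infinity>"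
  shows "(\<integral>\<^sup>+x\<in>{0..1}. (\<Sum>n. ennreal (cf_beta a x n * \<bar>h (cf_orbit a x n)\<bar>)) \<partial>lborel) < \<infinity>"
proof -
  let ?I = "\<integral>\<^sup>+x\<in>{0..alpha_bar a}. ennreal \<bar>h x\<bar> \<partial>lborel"
  let ?t = "\<lambda>n x. ennreal (cf_beta a x n * \<bar>h (cf_orbit a x n)\<bar>)"
  have bound: "(\<integral>\<^sup>+x\<in>{0..1}. ?t n x \<partial>lborel) \<le> 2 * (ennreal ((5 / 6)^n) * ?I)" for n
  proof -
    let ?H = "\<lambda>y. ennreal (cf_prod a y n) * ennreal \<bar>h ((cf_map a ^^ n) y)\<bar>"
    have "(\<integral>\<^sup>+x\<in>{0..1}. ?t n x \<partial>lborel) = (\<integral>\<^sup>+x\<in>{0..1}. ?H (cf_fold (alpha_bar a) x) \<partial>lborel)"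
      using cf_beta_nonneg[OF a(1,2)]
      by (intro nn_integral_cong) (auto simp: indicator_def ennreal_mult cf_beta_eq cf_orbit_eq)
    also have "\<dots> \<le> 2 * (\<integral>\<^sup>+y\<in>{0..alpha_bar (alpha_bar a)}. ?H y \<partial>lborel)"
      by (rule nn_integral_cf_fold_le) (use a alpha_bar_ge_half[of a] in auto)
    also have "\<dots> \<le> 2 * (ennreal ((5 / 6)^n) * ?I)"
      unfolding alpha_bar_alpha_bar[OF a(1,2)] using a
      by (intro mult_left_mono nn_integral_cf_iterate_le) auto
    finally show ?thesis .
  qed
  have "(\<integral>\<^sup>+x\<in>{0..1}. (\<Sum>n. ?t n x) \<partial>lborel) = (\<integral>\<^sup>+x. (\<Sum>n. ?t n x * indicator {0..1} x) \<partial>lborel)"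
    by simp
  also have "\<dots> = (\<Sum>n. \<integral>\<^sup>+x\<in>{0..1}. ?t n x \<partial>lborel)"
    by (rule nn_integral_suminf) measurable
  also have "\<dots> \<le> (\<Sum>n. 2 * (ennreal ((5 / 6)^n) * ?I))"
    by (intro suminf_le bound) auto
  also have "\<dots> = 2 * ((\<Sum>n. ennreal ((5 / 6)^n)) * ?I)"
    by simp
  also have "(\<Sum>n. ennreal ((5 / 6 :: real)^n)) = ennreal (\<Sum>n. (5 / 6)^n)"
    by (intro suminf_ennreal2 summable_geometric) auto
  also have "2 * (ennreal (\<Sum>n. (5 / 6)^n) * ?I) < \<infinity>"
    using fin by (auto simp: ennreal_mult_less_top)
  finally show ?thesis .
qed

lemma AE_summable_cf_series:
  fixes h :: "real \<Rightarrow> real"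
  assumes [measurable]: "h \<in> borel_measurable borel" and a: "0 \<le> a" "a \<le> 1" "alpha_bar a \<le> 5 / 8"
    and fin: "(\<integral>\<^sup>+x\<in>{0..alpha_bar a}. ennreal \<bar>h x\<bar> \<partial>lborel) < \<infinity>"
  shows "AE x in lborel. summable (\<lambda>n. cf_beta a x n * \<bar>h (cf_orbit a x n)\<bar>)"
proof -
  let ?S = "\<lambda>x. \<Sum>n. ennreal (cf_beta a x n * \<bar>h (cf_orbit a x n)\<bar>)"
  have per: "?S (x + 1) = ?S x" for x
    using cf_fold_periodic[of "alpha_bar a" x 1] by (simp add: cf_beta_eq cf_orbit_eq)
  have "AE x in lborel. ?S x * indicator {of_int k..of_int k + 1} x \<noteq> \<infinity>" for k :: int
  proof (rule nn_integral_PInf_AE)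
    have "(\<integral>\<^sup>+x\<in>{of_int k..of_int k + 1}. ?S x \<partial>lborel) = (\<integral>\<^sup>+x\<in>{0..1}. ?S x \<partial>lborel)"
      by (rule nn_integral_period) (auto simp: per)
    then show "(\<integral>\<^sup>+x\<in>{of_int k..of_int k + 1}. ?S x \<partial>lborel) \<noteq> \<infinity>"
      using nn_integral_cf_series_finite[OF assms] by auto
  qed measurable
  then have "AE x in lborel. \<forall>k::int. ?S x * indicator {of_int k..of_int k + 1} x \<noteq> \<infinity>"
    by (simp add: AE_all_countable)
  then show ?thesis
  proof eventually_elim
    case (elim x)
    have "x \<in> {of_int \<lfloor>x\<rfloor>..of_int \<lfloor>x\<rfloor> + 1}" by simp
    then have "?S x \<noteq> \<infinity>" using elim[rule_format, of "\<lfloor>x\<rfloor>"] by simp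
    then show ?case
      using cf_beta_nonneg[OF a(1,2)] by (intro summable_suminf_not_top) auto
  qed
qed

section \<open>Bounded mean oscillation from a functional equation\<close>

text \<open>The mean distance of \<open>f\<close> on \<open>[a, b]\<close> to a suitable constant is at most \<open>K\<close>; the inequality is
  multiplied by the length.\<close>

definition osc_le :: "(real \<Rightarrow> real) \<Rightarrow> real \<Rightarrow> real \<Rightarrow> real \<Rightarrow> bool" where
  "osc_le f K a b \<longleftrightarrow> (\<exists>c. (\<integral>\<^sup>+x\<in>{a..b}. ennreal \<bar>f x - c\<bar> \<partial>lborel) \<le> ennreal (K * (b - a)))"

lemma osc_leI:
  "(\<integral>\<^sup>+x\<in>{a..b}. ennreal \<bar>f x - c\<bar> \<partial>lborel) \<le> ennreal (K * (b - a)) \<Longrightarrow> osc_le f K a b"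
  by (auto simp: osc_le_def)

lemma osc_le_mono:
  assumes "osc_le f K a b" "K \<le> K'" "a \<le> b"
  shows "osc_le f K' a b"
proof -
  have "ennreal (K * (b - a)) \<le> ennreal (K' * (b - a))"
    using assms by (intro ennreal_leI mult_right_mono) auto
  then show ?thesis using assms(1) unfolding osc_le_def by (meson order_trans)
qed

text \<open>An even 1-periodic integrable function \<open>F\<close> with \<open>F(x) = - log x - x F(1/x)\<close> almost everywhere on
  the half period, \<open>L\<close> being a bound for its integral over a period.\<close>

locale log_inversion =
  fixes F :: "real \<Rightarrow> real" and L :: real
  assumes measurable_F [measurable]: "F \<in> borel_measurable borel"
    and periodic: "F (x + of_int k) = F x"
    and even: "F (- x) = F x"
    and integral_le: "(\<integral>\<^sup>+x\<in>{0..1}. ennreal \<bar>F x\<bar> \<partial>lborel) \<le> ennreal L"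
    and L_nonneg: "0 \<le> L"
    and inversion: "AE x in lborel. 0 < x \<and> x < 1 / 2 \<longrightarrow> F x = - ln x - x * F (1 / x)"
begin

lemma osc_le_shift:
  assumes "osc_le F K a b"
  shows "osc_le F K (a + of_int k) (b + of_int k)"
proof -
  obtain c where c: "(\<integral>\<^sup>+x\<in>{a..b}. ennreal \<bar>F x - c\<bar> \<partial>lborel) \<le> ennreal (K * (b - a))"
    using assms by (auto simp: osc_le_def)
  have "(\<integral>\<^sup>+x\<in>{a + of_int k..b + of_int k}. ennreal \<bar>F x - c\<bar> \<partial>lborel)
      = (\<integral>\<^sup>+x\<in>{a..b}. ennreal \<bar>F (x + of_int k) - c\<bar> \<partial>lborel)"
    by (rule nn_integral_shift[symmetric]) measurable
  also have "\<dots> = (\<integral>\<^sup>+x\<in>{a..b}. ennreal \<bar>F x - c\<bar> \<partial>lborel)" by (simp add: periodic)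
  finally show ?thesis using c unfolding osc_le_def by (intro exI[of _ c]) simp
qed

lemma F_reflect: "F (of_int k - x) = F x"
  using periodic[of "- x" k] even[of x] by simp

lemma osc_le_reflect:
  assumes "osc_le F K a b"
  shows "osc_le F K (of_int k - b) (of_int k - a)"
proof -
  obtain c where c: "(\<integral>\<^sup>+x\<in>{a..b}. ennreal \<bar>F x - c\<bar> \<partial>lborel) \<le> ennreal (K * (b - a))"
    using assms by (auto simp: osc_le_def)
  have "(\<integral>\<^sup>+x\<in>{of_int k - b..of_int k - a}. ennreal \<bar>F x - c\<bar> \<partial>lborel)
      = (\<integral>\<^sup>+x\<in>{a..b}. ennreal \<bar>F (of_int k - x) - c\<bar> \<partial>lborel)"
    by (rule nn_integral_reflect[symmetric]) measurable
  also have "\<dots> = (\<integral>\<^sup>+x\<in>{a..b}. ennreal \<bar>F x - c\<bar> \<partial>lborel)" by (simp add: F_reflect)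
  finally show ?thesis using c unfolding osc_le_def by (intro exI[of _ c]) simp
qed

lemma integral_Icc_le:
  assumes "a \<le> b"
  shows "(\<integral>\<^sup>+x\<in>{a..b}. ennreal \<bar>F x\<bar> \<partial>lborel) \<le> ennreal (L * (b - a + 1))"
proof -
  have *: "(\<integral>\<^sup>+x\<in>{a..a + real n}. ennreal \<bar>F x\<bar> \<partial>lborel) \<le> ennreal (L * real n)" for n
  proof (induction n)
    case 0
    have "AE x in lborel. x \<noteq> a" by (rule AE_lborel_singleton)
    then have "(\<integral>\<^sup>+x\<in>{a..a + real 0}. ennreal \<bar>F x\<bar> \<partial>lborel) = (\<integral>\<^sup>+x. 0 \<partial>(lborel :: real measure))"
      by (intro nn_integral_cong_AE) (auto simp: indicator_def)
    then show ?case by simp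
  next
    case (Suc n)
    have one: "(\<integral>\<^sup>+x\<in>{a + real n..(a + real n) + 1}. ennreal \<bar>F x\<bar> \<partial>lborel) \<le> ennreal L"
      using integral_le periodic[of _ 1] by (subst nn_integral_period) auto
    have "(\<integral>\<^sup>+x\<in>{a..a + real (Suc n)}. ennreal \<bar>F x\<bar> \<partial>lborel)
        = (\<integral>\<^sup>+x\<in>{a..a + real n}. ennreal \<bar>F x\<bar> \<partial>lborel)
          + (\<integral>\<^sup>+x\<in>{a + real n..(a + real n) + 1}. ennreal \<bar>F x\<bar> \<partial>lborel)"
      by (subst nn_integral_split[of _ _ "a + real n"]) (auto simp: add_ac)
    also have "\<dots> \<le> ennreal (L * real n) + ennreal L"
      by (rule add_mono[OF Suc one])
    also have "\<dots> = ennreal (L * real (Suc n))"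
      using L_nonneg by (simp add: ennreal_plus[symmetric] algebra_simps del: ennreal_plus)
    finally show ?case .
  qed
  define n where "n = nat \<lceil>b - a\<rceil>"
  have n: "b \<le> a + real n" "real n \<le> b - a + 1" using assms unfolding n_def by linarith+
  have "(\<integral>\<^sup>+x\<in>{a..b}. ennreal \<bar>F x\<bar> \<partial>lborel) \<le> (\<integral>\<^sup>+x\<in>{a..a + real n}. ennreal \<bar>F x\<bar> \<partial>lborel)"
    using n by (intro nn_integral_mono_set) auto
  also note *
  also have "ennreal (L * real n) \<le> ennreal (L * (b - a + 1))"
    using n L_nonneg by (intro ennreal_leI mult_left_mono) auto
  finally show ?thesis .
qed

lemma integral_cubic_weight_le:
  assumes "2 \<le> A" "A \<le> B"
  shows "(\<integral>\<^sup>+v\<in>{A..B}. ennreal \<bar>F v\<bar> * ennreal (1 / v^3) \<partial>lborel)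
    \<le> ennreal (L * ((B - A + 1) / ((A - 1/2)\<^sup>2 * (B - 1/2))))"
proof -
  define n where "n = nat \<lceil>B - A\<rceil>"
  have n: "B \<le> A + real n" "real n \<le> B - A + 1" using assms unfolding n_def by linarith+
  define p where "p = A - 1/2"
  define q where "q = A + real n - 1/2"
  have pq: "0 < p" "p \<le> q" "B - 1/2 \<le> q" using assms n by (auto simp: p_def q_def)
  have "(1 / p\<^sup>2 - 1 / q\<^sup>2) / 2 = (q - p) * (q + p) / (2 * p\<^sup>2 * q\<^sup>2)"
    using pq by (simp add: field_simps power2_eq_square)
  also have "\<dots> \<le> (q - p) * (2 * q) / (2 * p\<^sup>2 * q\<^sup>2)"
    using pq by (intro divide_right_mono mult_left_mono) auto
  also have "\<dots> = (q - p) / (p\<^sup>2 * q)"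
    using pq by (simp add: power2_eq_square)
  also have "\<dots> \<le> (B - A + 1) / (p\<^sup>2 * (B - 1/2))"
    using pq n assms by (intro frac_le mult_left_mono mult_pos_pos) (auto simp: p_def q_def)
  finally have le: "(1 / p\<^sup>2 - 1 / q\<^sup>2) / 2 \<le> (B - A + 1) / (p\<^sup>2 * (B - 1/2))" .
  have nn: "0 \<le> (B - A + 1) / (p\<^sup>2 * (B - 1/2))" using assms by simp
  have "(\<integral>\<^sup>+v\<in>{A..B}. ennreal \<bar>F v\<bar> * ennreal (1 / v^3) \<partial>lborel)
      \<le> (\<integral>\<^sup>+v\<in>{A..A + real n}. ennreal \<bar>F v\<bar> * ennreal (1 / v^3) \<partial>lborel)"
    using n by (intro nn_integral_mono_set) auto
  also have "\<dots> \<le> ennreal ((1 / p\<^sup>2 - 1 / q\<^sup>2) / 2) * (\<integral>\<^sup>+x\<in>{0..1}. ennreal \<bar>F x\<bar> \<partial>lborel)"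
    unfolding p_def q_def
    by (rule nn_integral_periodic_cubic_weight) (use assms periodic[of _ 1] in auto)
  also have "\<dots> \<le> ennreal ((B - A + 1) / (p\<^sup>2 * (B - 1/2))) * ennreal L"
    by (intro mult_mono ennreal_leI le integral_le) auto
  also have "\<dots> = ennreal (L * ((B - A + 1) / (p\<^sup>2 * (B - 1/2))))"
    using nn L_nonneg by (simp add: ennreal_mult[symmetric] mult.commute)
  finally show ?thesis by (simp add: p_def)
qed

lemma integral_inversion:
  assumes "0 < a" "a < b"
  shows "(\<integral>\<^sup>+x\<in>{a..b}. ennreal (x * \<bar>F (1 / x) - k\<bar>) \<partial>lborel)
       = (\<integral>\<^sup>+v\<in>{1 / b..1 / a}. ennreal \<bar>F v - k\<bar> * ennreal (1 / v^3) \<partial>lborel)"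
proof -
  have "(\<integral>\<^sup>+x\<in>{a..b}. ennreal (x * \<bar>F (1 / x) - k\<bar>) \<partial>lborel)
      = (\<integral>\<^sup>+v\<in>{1 / b..1 / a}. ennreal (1 / v * \<bar>F (1 / (1 / v)) - k\<bar>) * ennreal (1 / v\<^sup>2) \<partial>lborel)"
    by (rule nn_integral_inversion) (use assms in auto)
  also have "\<dots> = (\<integral>\<^sup>+v\<in>{1 / b..1 / a}. ennreal \<bar>F v - k\<bar> * ennreal (1 / v^3) \<partial>lborel)"
  proof (intro nn_integral_cong)
    fix v
    show "ennreal (1 / v * \<bar>F (1 / (1 / v)) - k\<bar>) * ennreal (1 / v\<^sup>2) * indicator {1 / b..1 / a} v
        = ennreal \<bar>F v - k\<bar> * ennreal (1 / v^3) * indicator {1 / b..1 / a} v"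
    proof (cases "v \<in> {1 / b..1 / a}")
      case True
      have "0 < 1 / b" using assms by simp
      moreover have "1 / b \<le> v" using True by simp
      ultimately have "v > 0" by linarith
      then show ?thesis
        by (simp add: ennreal_mult[symmetric] power2_eq_square power3_eq_cube mult.assoc)
    qed simp
  qed
  finally show ?thesis .
qed

text \<open>Where \<open>[a, b]\<close> is so large that its inverse has length at least 1/2, the second summand of the
  functional equation is bounded in mean, whatever its oscillation.\<close>

lemma integral_far:
  assumes "0 < a" "a < b" "b \<le> 1 / 2" "1 / 2 \<le> 1 / a - 1 / b"
  shows "(\<integral>\<^sup>+x\<in>{a..b}. ennreal \<bar>F x - (- ln b)\<bar> \<partial>lborel) \<le> ennreal ((1 + 6 * L) * (b - a))"
proof -
  define A where "A = 1 / b"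
  define B where "B = 1 / a"
  have AB: "2 \<le> A" "A \<le> B" "1 / 2 \<le> B - A" "(B - A) / (A * B) = b - a"
    using assms by (auto simp: A_def B_def field_simps)
  have ne: "AE x in lborel. x \<noteq> (1 / 2 :: real)" by (rule AE_lborel_singleton)
  have "(\<integral>\<^sup>+x\<in>{a..b}. ennreal \<bar>F x - (- ln b)\<bar> \<partial>lborel)
      \<le> (\<integral>\<^sup>+x. ennreal (ln (b / x)) * indicator {a..b} x
              + ennreal (x * \<bar>F (1 / x) - 0\<bar>) * indicator {a..b} x \<partial>lborel)"
  proof (rule nn_integral_mono_AE, use inversion ne in eventually_elim)
    case (elim x)
    show ?case
    proof (cases "x \<in> {a..b}")
      case True
      then have x: "0 < x" "x < 1 / 2" "x \<le> b" using assms elim by auto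
      then have F: "F x = - ln x - x * F (1 / x)" using elim by auto
      have xF: "\<bar>x * F (1 / x)\<bar> = x * \<bar>F (1 / x) - 0\<bar>" using x by (simp add: abs_mult)
      have "ln (b / x) = ln b - ln x" "0 \<le> ln (b / x)" using x by (auto simp: ln_div)
      then have "\<bar>F x - (- ln b)\<bar> \<le> ln (b / x) + x * \<bar>F (1 / x) - 0\<bar>"
        using xF unfolding F by linarith
      then have "ennreal \<bar>F x - (- ln b)\<bar> \<le> ennreal (ln (b / x)) + ennreal (x * \<bar>F (1 / x) - 0\<bar>)"
        using x \<open>0 \<le> ln (b / x)\<close>
        by (auto simp: ennreal_plus[symmetric] simp del: ennreal_plus intro!: ennreal_leI)
      then show ?thesis using True by simp
    qed simp
  qed
  also have "\<dots> = (\<integral>\<^sup>+x\<in>{a..b}. ennreal (ln (b / x)) \<partial>lborel)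
      + (\<integral>\<^sup>+x\<in>{a..b}. ennreal (x * \<bar>F (1 / x) - 0\<bar>) \<partial>lborel)"
    by (rule nn_integral_add) measurable
  also have "\<dots> \<le> ennreal (b - a) + ennreal (L * (6 * (b - a)))"
  proof (rule add_mono)
    show "(\<integral>\<^sup>+x\<in>{a..b}. ennreal (ln (b / x)) \<partial>lborel) \<le> ennreal (b - a)"
      using assms by (intro nn_integral_log_Icc) auto
    have "(B - A + 1) / ((A - 1/2)\<^sup>2 * (B - 1/2)) \<le> (3 * (B - A)) / (A * (B / 2))"
    proof (intro frac_le mult_mono)
      have "2 * A \<le> A * A" using AB by (intro mult_right_mono) auto
      moreover have "(A - 1/2)\<^sup>2 = A * A - A + 1 / 4" by (simp add: power2_eq_square algebra_simps)
      ultimately show "A \<le> (A - 1/2)\<^sup>2" by linarith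
    qed (use AB in auto)
    also have "\<dots> = 6 * (b - a)" unfolding AB(4)[symmetric] by simp
    finally have le: "(B - A + 1) / ((A - 1/2)\<^sup>2 * (B - 1/2)) \<le> 6 * (b - a)" .
    have "(\<integral>\<^sup>+x\<in>{a..b}. ennreal (x * \<bar>F (1 / x) - 0\<bar>) \<partial>lborel)
        \<le> ennreal (L * ((B - A + 1) / ((A - 1/2)\<^sup>2 * (B - 1/2))))"
      using integral_cubic_weight_le[OF AB(1,2)]
      unfolding integral_inversion[OF assms(1,2), of 0] A_def[symmetric] B_def[symmetric] by simp
    also have "\<dots> \<le> ennreal (L * (6 * (b - a)))"
      by (intro ennreal_leI mult_left_mono le L_nonneg)
    finally show "(\<integral>\<^sup>+x\<in>{a..b}. ennreal (x * \<bar>F (1 / x) - 0\<bar>) \<partial>lborel) \<le> ennreal (L * (6 * (b - a)))" .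
  qed
  also have "\<dots> = ennreal ((1 + 6 * L) * (b - a))"
    using assms L_nonneg by (subst ennreal_plus[symmetric]) (auto simp: algebra_simps intro!: mult_left_mono)
  finally show ?thesis .
qed

text \<open>Since the constant \<open>- log b\<close> does not depend on the left end, that end may tend to 0.\<close>

lemma integral_from_zero:
  assumes "0 < t" "t \<le> 1 / 2"
  shows "(\<integral>\<^sup>+x\<in>{0..t}. ennreal \<bar>F x - (- ln t)\<bar> \<partial>lborel) \<le> ennreal ((1 + 6 * L) * t)"
proof (rule nn_integral_Icc_from_zero)
  fix e assume e: "0 < e" "e < t"
  \<comment> \<open>Enlarging the interval makes its inverse long enough.\<close>
  define a where "a = min e (t / 2)"
  have a: "0 < a" "a < t" "a \<le> e" "a \<le> t / 2" using e by (auto simp: a_def)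
  have "2 / t \<le> 1 / a" using a assms by (simp add: field_simps)
  moreover have "1 / 2 \<le> 1 / t" using assms by (simp add: field_simps)
  ultimately have far: "1 / 2 \<le> 1 / a - 1 / t" by simp
  have "(\<integral>\<^sup>+x\<in>{e..t}. ennreal \<bar>F x - (- ln t)\<bar> \<partial>lborel) \<le> (\<integral>\<^sup>+x\<in>{a..t}. ennreal \<bar>F x - (- ln t)\<bar> \<partial>lborel)"
    using a by (intro nn_integral_mono_set) auto
  also have "\<dots> \<le> ennreal ((1 + 6 * L) * (t - a))"
    by (rule integral_far[OF a(1,2) assms(2) far])
  also have "\<dots> \<le> ennreal ((1 + 6 * L) * t)"
    using a L_nonneg by (intro ennreal_leI mult_left_mono) auto
  finally show "(\<integral>\<^sup>+x\<in>{e..t}. ennreal \<bar>F x - (- ln t)\<bar> \<partial>lborel) \<le> ennreal ((1 + 6 * L) * t)" .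
qed (use assms in auto)

text \<open>An interval around an integer is folded at it, at the price of a factor 2.\<close>

lemma osc_le_at_integer:
  assumes "0 \<le> s" "s \<le> 1 / 2" "0 \<le> t" "t \<le> 1 / 2" "0 < s + t"
  shows "osc_le F (2 * (1 + 6 * L)) (of_int m - s) (of_int m + t)"
proof -
  define u where "u = max s t"
  have u: "0 < u" "u \<le> 1 / 2" "s \<le> u" "t \<le> u" "u \<le> s + t" using assms by (auto simp: u_def)
  let ?f = "\<lambda>x. ennreal \<bar>F x - (- ln u)\<bar>"
  have "(\<integral>\<^sup>+x\<in>{- s..0}. ?f x \<partial>lborel) = (\<integral>\<^sup>+x\<in>{- s..0}. ?f (0 - x) \<partial>lborel)"
    by (simp add: even)
  also have "\<dots> = (\<integral>\<^sup>+x\<in>{0..s}. ?f x \<partial>lborel)" by (subst nn_integral_reflect) auto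
  finally have refl: "(\<integral>\<^sup>+x\<in>{- s..0}. ?f x \<partial>lborel) = (\<integral>\<^sup>+x\<in>{0..s}. ?f x \<partial>lborel)" .
  have le: "(\<integral>\<^sup>+x\<in>{0..r}. ?f x \<partial>lborel) \<le> ennreal ((1 + 6 * L) * (s + t))" if "r \<le> u" for r
  proof -
    have "(\<integral>\<^sup>+x\<in>{0..r}. ?f x \<partial>lborel) \<le> (\<integral>\<^sup>+x\<in>{0..u}. ?f x \<partial>lborel)"
      using that by (intro nn_integral_mono_set) auto
    also have "\<dots> \<le> ennreal ((1 + 6 * L) * u)" by (rule integral_from_zero[OF u(1,2)])
    also have "\<dots> \<le> ennreal ((1 + 6 * L) * (s + t))"
      using u L_nonneg by (intro ennreal_leI mult_left_mono) auto
    finally show ?thesis .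
  qed
  have "(\<integral>\<^sup>+x\<in>{- s..t}. ?f x \<partial>lborel) = (\<integral>\<^sup>+x\<in>{- s..0}. ?f x \<partial>lborel) + (\<integral>\<^sup>+x\<in>{0..t}. ?f x \<partial>lborel)"
    using assms by (intro nn_integral_split) auto
  also have "\<dots> \<le> ennreal ((1 + 6 * L) * (s + t)) + ennreal ((1 + 6 * L) * (s + t))"
    unfolding refl by (intro add_mono le u)
  also have "\<dots> = ennreal (2 * (1 + 6 * L) * (t - (- s)))"
    using assms L_nonneg by (subst ennreal_plus[symmetric]) (auto simp: algebra_simps)
  finally have "osc_le F (2 * (1 + 6 * L)) (- s) t" by (rule osc_leI)
  from osc_le_shift[OF this, of m] show ?thesis by (simp add: add.commute)
qed

text \<open>The contraction of oscillations: the weight \<open>x\<close> and the distortion of the inversion together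
  cost a factor at most 5/8, and replacing \<open>x\<close> by a constant in front of the mean of \<open>F\<close> costs at
  most 1/8 more.\<close>

lemma osc_le_inversion:
  assumes "0 < a" "a < b" "b \<le> 1 / 2" "1 / a - 1 / b \<le> 1 / 2" "0 \<le> K"
    and "osc_le F K (1 / b) (1 / a)"
  shows "osc_le F (1 + L / 2 + 3 / 4 * K) a b"
proof -
  define A where "A = 1 / b"
  define B where "B = 1 / a"
  have AB: "2 \<le> A" "A < B" "B - A \<le> 1 / 2" "(B - A) / (A * B) = b - a"
    using assms by (auto simp: A_def B_def field_simps)
  obtain k where k: "(\<integral>\<^sup>+v\<in>{A..B}. ennreal \<bar>F v - k\<bar> \<partial>lborel) \<le> ennreal (K * (B - A))"
    using assms(6) by (auto simp: osc_le_def A_def B_def)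
  have "4 \<le> A * A" using AB(1) mult_mono[of 2 A 2 A] by simp
  also have "\<dots> \<le> A * B" using AB by (intro mult_left_mono) auto
  finally have AB4: "4 \<le> A * B" .
  have k_le: "\<bar>k\<bar> * (b - a) \<le> L / 2 + K / 8"
  proof -
    have "ennreal (\<bar>k\<bar> * (B - A)) = (\<integral>\<^sup>+v\<in>{A..B}. ennreal \<bar>k\<bar> \<partial>lborel)"
      using AB by (subst nn_integral_const_Icc) auto
    also have "\<dots> \<le> (\<integral>\<^sup>+v. ennreal \<bar>F v\<bar> * indicator {A..B} v + ennreal \<bar>F v - k\<bar> * indicator {A..B} v \<partial>lborel)"
      by (intro nn_integral_mono)
        (auto simp: indicator_def ennreal_plus[symmetric] simp del: ennreal_plus intro!: ennreal_leI)
    also have "\<dots> = (\<integral>\<^sup>+v\<in>{A..B}. ennreal \<bar>F v\<bar> \<partial>lborel) + (\<integral>\<^sup>+v\<in>{A..B}. ennreal \<bar>F v - k\<bar> \<partial>lborel)"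
      by (rule nn_integral_add) measurable
    also have "\<dots> \<le> ennreal (L * (B - A + 1)) + ennreal (K * (B - A))"
      by (intro add_mono integral_Icc_le k) (use AB in auto)
    also have "\<dots> = ennreal (L * (B - A + 1) + K * (B - A))"
      using AB L_nonneg assms by (subst ennreal_plus) auto
    finally have "\<bar>k\<bar> * (B - A) \<le> L * (B - A + 1) + K * (B - A)"
      using AB L_nonneg assms by (subst (asm) ennreal_le_iff) auto
    also have "\<dots> \<le> L * 2 + K * (1 / 2)"
      using AB L_nonneg assms by (intro add_mono mult_left_mono) auto
    finally have "\<bar>k\<bar> * (B - A) / (A * B) \<le> (L * 2 + K * (1 / 2)) / 4"
      using AB4 AB L_nonneg assms by (intro frac_le) auto
    moreover have "\<bar>k\<bar> * (B - A) / (A * B) = \<bar>k\<bar> * (b - a)" unfolding AB(4)[symmetric] by simp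
    ultimately show ?thesis by simp
  qed
  have B_le: "B / A\<^sup>2 \<le> 5 / 8"
  proof -
    have "2 * A \<le> A * A" using AB by (intro mult_right_mono) auto
    then have "8 * B \<le> 5 * A\<^sup>2" unfolding power2_eq_square using AB by linarith
    then show ?thesis using AB by (simp add: field_simps)
  qed
  have inv: "(\<integral>\<^sup>+x\<in>{a..b}. ennreal (x * \<bar>F (1 / x) - k\<bar>) \<partial>lborel) \<le> ennreal (5 / 8 * K * (b - a))"
  proof -
    have "(\<integral>\<^sup>+x\<in>{a..b}. ennreal (x * \<bar>F (1 / x) - k\<bar>) \<partial>lborel)
        = (\<integral>\<^sup>+v\<in>{A..B}. ennreal \<bar>F v - k\<bar> * ennreal (1 / v^3) \<partial>lborel)"
      unfolding A_def B_def using assms by (intro integral_inversion) auto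
    also have "\<dots> \<le> (\<integral>\<^sup>+v\<in>{A..B}. ennreal (1 / A^3) * ennreal \<bar>F v - k\<bar> \<partial>lborel)"
    proof (rule nn_integral_mono_on)
      fix v assume v: "v \<in> {A..B}"
      then have "A^3 \<le> v^3" using AB by (intro power_mono) auto
      then have "1 / v^3 \<le> 1 / A^3" using AB v by (intro divide_left_mono mult_pos_pos) auto
      then show "ennreal \<bar>F v - k\<bar> * ennreal (1 / v^3) \<le> ennreal (1 / A^3) * ennreal \<bar>F v - k\<bar>"
        by (subst mult.commute) (intro mult_right_mono ennreal_leI, auto)
    qed
    also have "\<dots> = ennreal (1 / A^3) * (\<integral>\<^sup>+v\<in>{A..B}. ennreal \<bar>F v - k\<bar> \<partial>lborel)"
      unfolding mult.assoc by (rule nn_integral_cmult) measurable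
    also have "\<dots> \<le> ennreal (1 / A^3) * ennreal (K * (B - A))"
      by (intro mult_left_mono k) auto
    also have "\<dots> = ennreal (1 / A^3 * (K * (B - A)))"
      using AB assms by (intro ennreal_mult[symmetric]) auto
    also have "1 / A^3 * (K * (B - A)) = B / A\<^sup>2 * (K * (b - a))"
      using AB unfolding AB(4)[symmetric] by (simp add: power2_eq_square power3_eq_cube)
    also have "ennreal \<dots> \<le> ennreal (5 / 8 * (K * (b - a)))"
      using B_le assms by (intro ennreal_leI mult_right_mono) auto
    finally show ?thesis by (simp add: mult.assoc)
  qed
  have plus3: "ennreal p + ennreal q + ennreal r = ennreal (p + q + r)" if "0 \<le> p" "0 \<le> q" "0 \<le> r" for p q r
    using that by simp
  \<comment> \<open>The comparison constant is the right side of the functional equation at \<open>b\<close>, with \<open>k\<close> in place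
     of \<open>F (1 / b)\<close>.\<close>
  let ?c = "- ln b - b * k"
  have ne: "AE x in lborel. x \<noteq> (1 / 2 :: real)" by (rule AE_lborel_singleton)
  have "(\<integral>\<^sup>+x\<in>{a..b}. ennreal \<bar>F x - ?c\<bar> \<partial>lborel)
      \<le> (\<integral>\<^sup>+x. (ennreal (ln (b / x)) * indicator {a..b} x
              + ennreal (x * \<bar>F (1 / x) - k\<bar>) * indicator {a..b} x)
              + ennreal (\<bar>k\<bar> * (b - a)) * indicator {a..b} x \<partial>lborel)"
  proof (rule nn_integral_mono_AE, use inversion ne in eventually_elim)
    case (elim x)
    show ?case
    proof (cases "x \<in> {a..b}")
      case True
      then have x: "0 < x" "x < 1 / 2" "x \<le> b" "a \<le> x" using assms elim by auto
      then have F: "F x = - ln x - x * F (1 / x)" using elim by auto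
      have ln: "ln (b / x) = ln b - ln x" "0 \<le> ln (b / x)" using x by (auto simp: ln_div)
      have "F x - ?c = ln (b / x) - x * (F (1 / x) - k) + (b - x) * k"
        unfolding F ln(1) by (simp add: algebra_simps)
      moreover have "\<bar>x * (F (1 / x) - k)\<bar> = x * \<bar>F (1 / x) - k\<bar>" using x by (simp add: abs_mult)
      moreover have "\<bar>(b - x) * k\<bar> \<le> \<bar>k\<bar> * (b - a)"
        using x by (auto simp: abs_mult mult.commute intro!: mult_left_mono)
      ultimately have "\<bar>F x - ?c\<bar> \<le> (ln (b / x) + x * \<bar>F (1 / x) - k\<bar>) + \<bar>k\<bar> * (b - a)"
        using ln(2) by linarith
      then have "ennreal \<bar>F x - ?c\<bar>
        \<le> (ennreal (ln (b / x)) + ennreal (x * \<bar>F (1 / x) - k\<bar>)) + ennreal (\<bar>k\<bar> * (b - a))"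
        using x ln(2) assms(2)
        by (auto simp: ennreal_plus[symmetric] simp del: ennreal_plus intro!: ennreal_leI)
      then show ?thesis using True by simp
    qed simp
  qed
  also have "\<dots> = (\<integral>\<^sup>+x\<in>{a..b}. ennreal (ln (b / x)) \<partial>lborel)
      + (\<integral>\<^sup>+x\<in>{a..b}. ennreal (x * \<bar>F (1 / x) - k\<bar>) \<partial>lborel)
      + (\<integral>\<^sup>+x\<in>{a..b}. ennreal (\<bar>k\<bar> * (b - a)) \<partial>lborel)"
    by (simp add: nn_integral_add)
  also have "\<dots> \<le> ennreal (b - a) + ennreal (5 / 8 * K * (b - a)) + ennreal (\<bar>k\<bar> * (b - a) * (b - a))"
    using assms by (intro add_mono inv nn_integral_log_Icc nn_integral_const_Icc[THEN eq_refl]) auto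
  also have "\<dots> = ennreal ((1 + 5 / 8 * K + \<bar>k\<bar> * (b - a)) * (b - a))"
    using assms by (subst plus3) (simp_all add: distrib_right)
  also have "\<dots> \<le> ennreal ((1 + L / 2 + 3 / 4 * K) * (b - a))"
    using assms k_le by (intro ennreal_leI mult_right_mono) auto
  finally show ?thesis by (rule osc_leI)
qed

text \<open>An interval with right end 1/2 is inverted onto one with left end 2, where the oscillation is
  already controlled.\<close>

lemma osc_le_up_to_half:
  assumes "0 < t" "t \<le> 1 / 2"
  shows "osc_le F (3 + 10 * L) (1 / 2 - t) (1 / 2)"
proof (cases "1 / 10 \<le> t")
  case True
  have "(\<integral>\<^sup>+x\<in>{1 / 2 - t..1 / 2}. ennreal \<bar>F x - 0\<bar> \<partial>lborel) \<le> (\<integral>\<^sup>+x\<in>{0..1}. ennreal \<bar>F x\<bar> \<partial>lborel)"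
    using assms by (simp, intro nn_integral_mono_set) auto
  also note integral_le
  also have "ennreal L \<le> ennreal ((3 + 10 * L) * (1 / 2 - (1 / 2 - t)))"
  proof (rule ennreal_leI)
    have "L * 1 \<le> L * (10 * t)" using True L_nonneg by (intro mult_left_mono) auto
    then show "L \<le> (3 + 10 * L) * (1 / 2 - (1 / 2 - t))" using assms by (simp add: algebra_simps)
  qed
  finally show ?thesis by (rule osc_leI)
next
  case False
  define a where "a = 1 / 2 - t"
  have a: "0 < a" "a < 1 / 2" "2 / 5 < a" using assms False by (auto simp: a_def)
  have inv: "1 / a - 2 \<le> 1 / 2" "0 < 1 / a - 2" using a by (auto simp: field_simps)
  have "osc_le F (2 * (1 + 6 * L)) (of_int 2 - 0) (of_int 2 + (1 / a - 2))"
    by (rule osc_le_at_integer) (use inv in auto)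
  then have "osc_le F (2 * (1 + 6 * L)) (1 / (1 / 2)) (1 / a)" by simp
  then have "osc_le F (1 + L / 2 + 3 / 4 * (2 * (1 + 6 * L))) a (1 / 2)"
    using a inv L_nonneg by (intro osc_le_inversion) auto
  then show ?thesis unfolding a_def
    by (rule osc_le_mono) (use L_nonneg assms in \<open>auto simp: algebra_simps\<close>)
qed

lemma osc_le_at_half_integer:
  assumes "0 \<le> s" "s \<le> 1 / 2" "0 \<le> t" "t \<le> 1 / 2" "0 < s + t"
  shows "osc_le F (6 + 20 * L) (of_int m + 1 / 2 - s) (of_int m + 1 / 2 + t)"
proof -
  define u where "u = max s t"
  have u: "0 < u" "u \<le> 1 / 2" "s \<le> u" "t \<le> u" "u \<le> s + t" using assms by (auto simp: u_def)
  obtain c where c: "(\<integral>\<^sup>+x\<in>{1 / 2 - u..1 / 2}. ennreal \<bar>F x - c\<bar> \<partial>lborel)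
      \<le> ennreal ((3 + 10 * L) * (1 / 2 - (1 / 2 - u)))"
    using osc_le_up_to_half[OF u(1,2)] by (auto simp: osc_le_def)
  let ?f = "\<lambda>x. ennreal \<bar>F x - c\<bar>"
  have "(\<integral>\<^sup>+x\<in>{1 / 2..1 / 2 + t}. ?f x \<partial>lborel) = (\<integral>\<^sup>+x\<in>{1 / 2..1 / 2 + t}. ?f (1 - x) \<partial>lborel)"
    using F_reflect[of 1] by simp
  also have "\<dots> = (\<integral>\<^sup>+x\<in>{1 - (1 / 2 + t)..1 - 1 / 2}. ?f x \<partial>lborel)"
    by (rule nn_integral_reflect) measurable
  also have "\<dots> = (\<integral>\<^sup>+x\<in>{1 / 2 - t..1 / 2}. ?f x \<partial>lborel)"
    by (simp add: algebra_simps)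
  finally have refl: "(\<integral>\<^sup>+x\<in>{1 / 2..1 / 2 + t}. ?f x \<partial>lborel) = (\<integral>\<^sup>+x\<in>{1 / 2 - t..1 / 2}. ?f x \<partial>lborel)" .
  have le: "(\<integral>\<^sup>+x\<in>{1 / 2 - r..1 / 2}. ?f x \<partial>lborel) \<le> ennreal ((3 + 10 * L) * (s + t))" if "r \<le> u" for r
  proof -
    have "(\<integral>\<^sup>+x\<in>{1 / 2 - r..1 / 2}. ?f x \<partial>lborel) \<le> (\<integral>\<^sup>+x\<in>{1 / 2 - u..1 / 2}. ?f x \<partial>lborel)"
      using that by (intro nn_integral_mono_set) auto
    also note c
    also have "ennreal ((3 + 10 * L) * (1 / 2 - (1 / 2 - u))) \<le> ennreal ((3 + 10 * L) * (s + t))"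
      using u L_nonneg by (intro ennreal_leI mult_left_mono) auto
    finally show ?thesis .
  qed
  have "(\<integral>\<^sup>+x\<in>{1 / 2 - s..1 / 2 + t}. ?f x \<partial>lborel)
      = (\<integral>\<^sup>+x\<in>{1 / 2 - s..1 / 2}. ?f x \<partial>lborel) + (\<integral>\<^sup>+x\<in>{1 / 2..1 / 2 + t}. ?f x \<partial>lborel)"
    using assms by (intro nn_integral_split) auto
  also have "\<dots> \<le> ennreal ((3 + 10 * L) * (s + t)) + ennreal ((3 + 10 * L) * (s + t))"
    unfolding refl by (intro add_mono le u)
  also have "\<dots> = ennreal ((6 + 20 * L) * (1 / 2 + t - (1 / 2 - s)))"
    using assms L_nonneg by (subst ennreal_plus[symmetric]) (auto simp: algebra_simps)
  finally have "osc_le F (6 + 20 * L) (1 / 2 - s) (1 / 2 + t)" by (rule osc_leI)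
  from osc_le_shift[OF this, of m] show ?thesis by (simp add: algebra_simps)
qed

text \<open>Inversion lengthens an interval in the half period at least four times.  So, after finitely many
  steps, the images of a short interval meet an integer or a half-integer or have length at least 1/2, and the
  contraction carries the bound back.\<close>

lemma osc_le_short:
  assumes "a < b" "b - a \<le> 1 / 2" "(1 / 4)^n / 2 < b - a"
  shows "osc_le F (6 + 20 * L) a b"
  using assms
proof (induction n arbitrary: a b)
  case 0
  then show ?case by simp
next
  case (Suc n)
  let ?K = "6 + 20 * L"
  have inner: "osc_le F ?K c d" if cd: "0 < c" "c < d" "d < 1 / 2" "(1 / 4)^Suc n / 2 < d - c" for c d
  proof (cases "1 / 2 \<le> 1 / c - 1 / d")
    case True
    then have "osc_le F (1 + 6 * L) c d" using cd by (intro osc_leI[OF integral_far]) auto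
    then show ?thesis by (rule osc_le_mono) (use cd L_nonneg in auto)
  next
    case False
    have "c * d \<le> 1 / 2 * (1 / 2)" using cd by (intro mult_mono) auto
    then have "(d - c) / (1 / 4) \<le> (d - c) / (c * d)" using cd by (intro divide_left_mono mult_pos_pos) auto
    also have "\<dots> = 1 / c - 1 / d" using cd by (simp add: field_simps)
    finally have len: "4 * (d - c) \<le> 1 / c - 1 / d" by simp
    have "osc_le F ?K (1 / d) (1 / c)"
    proof (rule Suc.IH)
      have "(1 / 4 :: real)^n / 2 = 4 * ((1 / 4)^Suc n / 2)" by simp
      also have "\<dots> < 4 * (d - c)" by (rule mult_strict_left_mono[OF cd(4)]) simp
      also note len
      finally show "(1 / 4)^n / 2 < 1 / c - 1 / d" .
    qed (use False cd in \<open>auto simp: frac_less2\<close>)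
    then have "osc_le F (1 + L / 2 + 3 / 4 * ?K) c d"
      using cd False L_nonneg by (intro osc_le_inversion) auto
    then show ?thesis by (rule osc_le_mono) (use cd(2) L_nonneg in \<open>simp_all add: field_simps\<close>)
  qed
  show ?case
  proof (cases "\<exists>m::int. of_int m \<in> {a..b}")
    case True
    then obtain m :: int where m: "of_int m \<in> {a..b}" by blast
    have "osc_le F (2 * (1 + 6 * L)) (of_int m - (of_int m - a)) (of_int m + (b - of_int m))"
      by (rule osc_le_at_integer) (use m Suc.prems in auto)
    then have "osc_le F (2 * (1 + 6 * L)) a b" by simp
    then show ?thesis by (rule osc_le_mono) (use Suc.prems L_nonneg in auto)
  next
    case no_int: False
    show ?thesis
    proof (cases "\<exists>m::int. of_int m + 1 / 2 \<in> {a..b}")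
      case True
      then obtain m :: int where m: "of_int m + 1 / 2 \<in> {a..b}" by blast
      have "osc_le F ?K (of_int m + 1 / 2 - (of_int m + 1 / 2 - a)) (of_int m + 1 / 2 + (b - (of_int m + 1 / 2)))"
        by (rule osc_le_at_half_integer) (use m Suc.prems in auto)
      then show ?thesis by simp
    next
      case False
      define k where "k = \<lfloor>a\<rfloor>"
      have k: "of_int k < a" "b < of_int k + 1"
      proof -
        have "of_int k \<le> a" "a < of_int (k + 1)" unfolding k_def by linarith+
        moreover have "of_int k \<notin> {a..b}" "of_int (k + 1) \<notin> {a..b}" using no_int by blast+
        ultimately show "of_int k < a" "b < of_int k + 1" using Suc.prems by auto
      qed
      have "of_int k + 1 / 2 \<notin> {a..b}" using False by blast
      then consider "b < of_int k + 1 / 2" | "of_int k + 1 / 2 < a" by fastforce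
      then show ?thesis
      proof cases
        case 1
        have "osc_le F ?K (a - of_int k) (b - of_int k)"
          by (rule inner) (use 1 k Suc.prems in auto)
        from osc_le_shift[OF this, of k] show ?thesis by simp
      next
        case 2
        have "osc_le F ?K (of_int (k + 1) - b) (of_int (k + 1) - a)"
          by (rule inner) (use 2 k Suc.prems in auto)
        from osc_le_reflect[OF this, of "k + 1"] show ?thesis by simp
      qed
    qed
  qed
qed

proposition osc_le_all:
  assumes "a < b"
  shows "osc_le F (6 + 20 * L) a b"
proof (cases "b - a \<le> 1 / 2")
  case True
  have "(\<lambda>n. (1 / 4 :: real)^n) \<longlonglongrightarrow> 0" by (rule LIMSEQ_realpow_zero) auto
  then have "\<forall>\<^sub>F n in sequentially. (1 / 4)^n < b - a" using assms by (intro order_tendstoD) auto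
  then obtain n where "(1 / 4)^n < b - a" by (auto simp: eventually_sequentially)
  moreover have "(1 / 4 :: real)^n / 2 \<le> (1 / 4)^n" by simp
  ultimately show ?thesis using assms True by (intro osc_le_short[of _ _ n]) linarith+
next
  case False
  have "(\<integral>\<^sup>+x\<in>{a..b}. ennreal \<bar>F x - 0\<bar> \<partial>lborel) \<le> ennreal (L * (b - a + 1))"
    using integral_Icc_le[of a b] assms by simp
  also have "\<dots> \<le> ennreal ((6 + 20 * L) * (b - a))"
  proof (rule ennreal_leI)
    have "L * (b - a + 1) \<le> L * (20 * (b - a))" using False L_nonneg by (intro mult_left_mono) auto
    also have "\<dots> \<le> (6 + 20 * L) * (b - a)" using assms by (simp add: algebra_simps)
    finally show "L * (b - a + 1) \<le> (6 + 20 * L) * (b - a)" .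
  qed
  finally show ?thesis by (rule osc_leI)
qed

end

section \<open>From oscillation bounds to BMO\<close>

lemma osc_le_perturb:
  assumes [measurable]: "f \<in> borel_measurable borel" "h \<in> borel_measurable borel"
    and near: "AE x in lborel. \<bar>f x - h x\<bar> \<le> C"
    and "0 \<le> K" "0 \<le> C" "a \<le> b" "osc_le h K a b"
  shows "osc_le f (K + C) a b"
proof -
  obtain c where c: "(\<integral>\<^sup>+x\<in>{a..b}. ennreal \<bar>h x - c\<bar> \<partial>lborel) \<le> ennreal (K * (b - a))"
    using assms by (auto simp: osc_le_def)
  have "(\<integral>\<^sup>+x\<in>{a..b}. ennreal \<bar>f x - c\<bar> \<partial>lborel)
      \<le> (\<integral>\<^sup>+x. ennreal \<bar>h x - c\<bar> * indicator {a..b} x + ennreal C * indicator {a..b} x \<partial>lborel)"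
  proof (rule nn_integral_mono_AE, use near in eventually_elim)
    case (elim x)
    have "\<bar>f x - c\<bar> \<le> \<bar>h x - c\<bar> + C" using elim by linarith
    then have "ennreal \<bar>f x - c\<bar> \<le> ennreal \<bar>h x - c\<bar> + ennreal C"
      using \<open>0 \<le> C\<close> by (auto simp: ennreal_plus[symmetric] simp del: ennreal_plus intro!: ennreal_leI)
    then show ?case by (auto simp: indicator_def)
  qed
  also have "\<dots> = (\<integral>\<^sup>+x\<in>{a..b}. ennreal \<bar>h x - c\<bar> \<partial>lborel) + (\<integral>\<^sup>+x\<in>{a..b}. ennreal C \<partial>lborel)"
    by (rule nn_integral_add) measurable
  also have "\<dots> \<le> ennreal (K * (b - a)) + ennreal (C * (b - a))"
    using assms c by (intro add_mono nn_integral_const_Icc[THEN eq_refl]) auto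
  also have "\<dots> = ennreal ((K + C) * (b - a))"
    using assms by (subst ennreal_plus[symmetric]) (auto simp: distrib_right)
  finally show ?thesis by (rule osc_leI)
qed

lemma bounded_interval_cases:
  fixes I :: "real set"
  assumes "is_interval I" "bounded I" "measure lebesgue I > 0"
  obtains a b where "a < b" "{a<..<b} \<subseteq> I" "I \<subseteq> {a..b}"
proof -
  have ne: "I \<noteq> {}" using assms(3) by auto
  have bdd: "bdd_above I" "bdd_below I" using assms(2) by (auto simp: bounded_imp_bdd_above bounded_imp_bdd_below)
  have sub: "I \<subseteq> {Inf I..Sup I}" using bdd by (auto intro: cInf_lower cSup_upper)
  have "Inf I < Sup I"
  proof (rule ccontr)
    assume "\<not> Inf I < Sup I"
    then have "x = Inf I" if "x \<in> I" for x using subsetD[OF sub that] by simp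
    then obtain p where "I \<subseteq> {p}" by blast
    then have "I = {} \<or> I = {p}" by blast
    then have "measure lebesgue I = 0" by auto
    then show False using assms(3) by simp
  qed
  moreover have "{Inf I<..<Sup I} \<subseteq> I"
  proof
    fix x assume x: "x \<in> {Inf I<..<Sup I}"
    then obtain y z where "y \<in> I" "y < x" "z \<in> I" "x < z"
      using cInf_less_iff[OF ne bdd(2), of x] less_cSup_iff[OF ne bdd(1), of x] by auto
    then show "x \<in> I" using assms(1) by (meson is_interval_1 less_imp_le)
  qed
  ultimately show thesis using that sub by blast
qed

lemma BMO_if_osc_le:
  assumes [measurable]: "f \<in> borel_measurable borel" and "0 \<le> K"
    and osc: "\<And>a b. a < b \<Longrightarrow> osc_le f K a b"
  shows "f \<in> BMO"
proof -
  have int_Icc: "(\<integral>\<^sup>+x\<in>{a..b}. ennreal \<bar>f x\<bar> \<partial>lborel) < \<infinity>" if ab: "a < b" for a b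
  proof -
    obtain c where c: "(\<integral>\<^sup>+x\<in>{a..b}. ennreal \<bar>f x - c\<bar> \<partial>lborel) \<le> ennreal (K * (b - a))"
      using osc[OF ab] by (auto simp: osc_le_def)
    have "(\<integral>\<^sup>+x\<in>{a..b}. ennreal \<bar>f x\<bar> \<partial>lborel)
        \<le> (\<integral>\<^sup>+x. ennreal \<bar>f x - c\<bar> * indicator {a..b} x + ennreal \<bar>c\<bar> * indicator {a..b} x \<partial>lborel)"
      by (intro nn_integral_mono)
        (auto simp: indicator_def ennreal_plus[symmetric] simp del: ennreal_plus intro!: ennreal_leI)
    also have "\<dots> = (\<integral>\<^sup>+x\<in>{a..b}. ennreal \<bar>f x - c\<bar> \<partial>lborel) + (\<integral>\<^sup>+x\<in>{a..b}. ennreal \<bar>c\<bar> \<partial>lborel)"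
      by (rule nn_integral_add) measurable
    also have "\<dots> \<le> ennreal (K * (b - a)) + ennreal (\<bar>c\<bar> * (b - a))"
      using ab c by (intro add_mono nn_integral_const_Icc[THEN eq_refl]) auto
    also have "\<dots> < \<infinity>" by simp
    finally show ?thesis .
  qed
  have int: "set_integrable lebesgue A f" if A: "A \<in> sets borel" "A \<subseteq> {a..b}" "a < b" for A a b
  proof -
    have [measurable]: "A \<in> sets borel" by (rule A(1))
    have "integrable lborel (\<lambda>x. indicator A x *\<^sub>R f x)"
    proof (rule integrableI_bounded)
      have "(\<integral>\<^sup>+x. ennreal (norm (indicator A x *\<^sub>R f x)) \<partial>lborel) \<le> (\<integral>\<^sup>+x\<in>{a..b}. ennreal \<bar>f x\<bar> \<partial>lborel)"
        using A(2) by (intro nn_integral_mono) (auto simp: indicator_def)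
      also have "\<dots> < \<infinity>" by (rule int_Icc[OF A(3)])
      finally show "(\<integral>\<^sup>+x. ennreal (norm (indicator A x *\<^sub>R f x)) \<partial>lborel) < \<infinity>" .
    qed measurable
    then show ?thesis unfolding set_integrable_def
      by (subst integrable_completion) (auto simp: integrable_completion)
  qed
  have "locally_integrable f"
    unfolding locally_integrable_def
  proof (intro allI impI)
    fix A :: "real set" assume A: "compact A"
    then obtain r where "r > 0" "\<And>x. x \<in> A \<Longrightarrow> \<bar>x\<bar> \<le> r"
      using bounded_pos[of A] compact_imp_bounded[of A] by auto
    then have r: "A \<subseteq> {- r..r}" "r > 0" by (auto simp: abs_le_iff minus_le_iff)
    show "set_integrable lebesgue A f"
      by (rule int[of A "- r" r]) (use A r in \<open>auto simp: compact_imp_closed\<close>)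
  qed
  moreover have "mean_on I (\<lambda>x. \<bar>f x - mean_on I f\<bar>) \<le> 2 * K"
    if I: "is_interval I" "bounded I" "measure lebesgue I > 0" for I
  proof -
    obtain a b where ab: "a < b" "{a<..<b} \<subseteq> I" "I \<subseteq> {a..b}"
      using bounded_interval_cases[OF I] .
    have eq: "I = {a<..<b} \<union> (I \<inter> {a, b})" using ab by force
    have "I \<inter> {a, b} \<in> sets borel" by (intro borel_closed finite_imp_closed) simp
    then have Ib: "I \<in> sets borel" by (subst eq) (intro sets.Un greaterThanLessThan_borel)
    then have Il: "I \<in> sets lebesgue" by simp
    have fin: "I \<in> fmeasurable lebesgue"
      by (rule fmeasurableI2[of "{a..b}"]) (use ab Il in auto)
    have meas: "measure lebesgue I = b - a"
    proof (rule antisym)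
      show "measure lebesgue I \<le> b - a"
        using measure_mono_fmeasurable[of I "{a..b}" lebesgue] ab Il by auto
      show "b - a \<le> measure lebesgue I"
        using measure_mono_fmeasurable[of "{a<..<b}" I lebesgue] ab fin by auto
    qed
    obtain c where c: "(\<integral>\<^sup>+x\<in>{a..b}. ennreal \<bar>f x - c\<bar> \<partial>lborel) \<le> ennreal (K * (b - a))"
      using osc[OF ab(1)] by (auto simp: osc_le_def)
    have f_int: "set_integrable lebesgue I f" by (rule int[OF Ib ab(3,1)])
    have const: "set_integrable lebesgue I (\<lambda>x. d)" for d :: real
      using fin by (auto simp: set_integrable_def fmeasurable_def intro!: integrable_real_indicator)
    have diff: "set_integrable lebesgue I (\<lambda>x. f x - d)" for d
      by (intro set_integral_diff f_int const)
    have absd: "set_integrable lebesgue I (\<lambda>x. \<bar>f x - d\<bar>)" for d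
      by (intro set_integrable_abs diff)
    have lint_const: "(LINT x:I|lebesgue. d) = d * (b - a)" for d :: real
      using meas by (simp add: set_lebesgue_integral_def)
    define A where "A = (LINT x:I|lebesgue. \<bar>f x - c\<bar>)"
    define m where "m = mean_on I f"
    have "ennreal A = (\<integral>\<^sup>+x. ennreal (indicator I x *\<^sub>R \<bar>f x - c\<bar>) \<partial>lebesgue)"
      using absd[of c] unfolding A_def set_lebesgue_integral_def set_integrable_def
      by (intro nn_integral_eq_integral[symmetric]) auto
    also have "\<dots> = (\<integral>\<^sup>+x. ennreal (indicator I x *\<^sub>R \<bar>f x - c\<bar>) \<partial>lborel)"
      by (rule nn_integral_completion)
    also have "\<dots> \<le> (\<integral>\<^sup>+x\<in>{a..b}. ennreal \<bar>f x - c\<bar> \<partial>lborel)"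
      using ab(3) by (intro nn_integral_mono) (auto simp: indicator_def)
    also note c
    finally have A_le: "A \<le> K * (b - a)"
      using \<open>0 \<le> K\<close> ab by (subst (asm) ennreal_le_iff) auto
    have "m * (b - a) = (LINT x:I|lebesgue. f x)"
      using ab meas by (simp add: m_def mean_on_def)
    then have "(m - c) * (b - a) = (LINT x:I|lebesgue. f x - c)"
      using set_integral_diff(2)[OF f_int const, of c] by (simp add: lint_const left_diff_distrib)
    then have "\<bar>m - c\<bar> * (b - a) = \<bar>LINT x:I|lebesgue. f x - c\<bar>"
      using ab by (metis abs_mult abs_of_pos diff_gt_0_iff_gt)
    also have "\<dots> \<le> A"
      using set_integral_norm_bound[OF diff[of c]] by (simp add: A_def)
    finally have mc: "\<bar>m - c\<bar> * (b - a) \<le> A" .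
    have "(LINT x:I|lebesgue. \<bar>f x - m\<bar>) \<le> (LINT x:I|lebesgue. \<bar>f x - c\<bar> + \<bar>m - c\<bar>)"
      by (rule set_integral_mono) (auto intro!: absd set_integral_add const)
    also have "\<dots> = A + \<bar>m - c\<bar> * (b - a)"
      using set_integral_add(2)[OF absd const, of c "\<bar>m - c\<bar>"] by (simp add: A_def lint_const)
    also have "\<dots> \<le> 2 * K * (b - a)" using A_le mc by simp
    finally show ?thesis
      using ab meas by (simp add: mean_on_def m_def divide_le_eq)
  qed
  ultimately show ?thesis
    unfolding BMO_def by (auto intro!: bdd_aboveI[of _ "2 * K"])
qed

section \<open>The Wilton function for the parameter 1/2\<close>

lemma wilton_term_measurable [measurable]: "(\<lambda>x. wilton_term a x n) \<in> borel_measurable borel"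
  unfolding wilton_term_def by measurable

lemma wilton_measurable [measurable]: "wilton a \<in> borel_measurable borel"
proof -
  have [measurable]: "(\<rat> :: real set) \<in> sets borel"
    by (rule sets.countable) (auto intro: countable_rat)
  have "{x \<in> space borel. Cauchy (\<lambda>n. \<Sum>i<n. wilton_term a x i)} \<in> sets borel"
    by measurable
  then have [measurable]: "Measurable.pred borel (\<lambda>x. summable (wilton_term a x))"
    by (simp add: pred_def summable_iff_convergent Cauchy_convergent_iff)
  show ?thesis unfolding wilton_def wilton_defined_def by measurable
qed

lemma wilton_defined_irrational: "wilton_defined a x \<Longrightarrow> x \<notin> \<rat>"
  by (simp add: wilton_defined_def)

lemma abs_wilton_term:
  assumes "0 \<le> a" "a \<le> 1"
  shows "\<bar>wilton_term a x n\<bar> = cf_beta a x n * \<bar>ln (1 / cf_orbit a x n)\<bar>"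
  using cf_beta_nonneg[OF assms] by (simp add: wilton_term_def abs_mult power_abs)

lemma wilton_term_cong:
  "cf_fold (alpha_bar a) x = cf_fold (alpha_bar a) y \<Longrightarrow> wilton_term a x = wilton_term a y"
  by (simp add: fun_eq_iff wilton_term_def cf_beta_eq cf_orbit_eq)

lemma wilton_cong:
  assumes "cf_fold (alpha_bar a) x = cf_fold (alpha_bar a) y" "x \<in> \<rat> \<longleftrightarrow> y \<in> \<rat>"
  shows "wilton_defined a x \<longleftrightarrow> wilton_defined a y" "wilton a x = wilton a y"
  using wilton_term_cong[OF assms(1)] assms(2) by (simp_all add: wilton_defined_def wilton_def)

lemma Rats_add_int_iff: "x + of_int k \<in> \<rat> \<longleftrightarrow> (x :: real) \<in> \<rat>"
  by (metis Rats_add Rats_diff Rats_of_int add_diff_cancel_right')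

lemma wilton_shift:
  shows "wilton_defined a (x + of_int k) \<longleftrightarrow> wilton_defined a x" "wilton a (x + of_int k) = wilton a x"
  by (intro wilton_cong; simp add: cf_fold_periodic Rats_add_int_iff)+

lemma alpha_bar_half: "alpha_bar (1 / 2) = 1 / 2"
  by (simp add: alpha_bar_def)

lemma cf_fold_half_uminus: "cf_fold (1 / 2) (- x) = cf_fold (1 / 2) x"
proof -
  define n where "n = \<lfloor>x + 1 / 2\<rfloor>"
  have n: "of_int n \<le> x + 1 / 2" "x + 1 / 2 < of_int n + 1" unfolding n_def by linarith+
  have "x + 1 - 1 / 2 = x + 1 / 2" by simp
  then have fold: "cf_fold (1 / 2) x = \<bar>x - of_int n\<bar>" by (simp only: cf_fold_def n_def)
  show ?thesis
  proof (cases "of_int n = x + 1 / 2")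
    case True
    then have "- x + 1 - 1 / 2 = of_int (1 - n)" by simp
    then have "\<lfloor>- x + 1 - 1 / 2\<rfloor> = 1 - n" by (metis floor_of_int)
    then show ?thesis using True unfolding fold by (simp add: cf_fold_def)
  next
    case False
    then have "\<lfloor>- x + 1 - 1 / 2\<rfloor> = - n" using n by (subst floor_eq_iff) auto
    then show ?thesis unfolding fold by (simp add: cf_fold_def)
  qed
qed

lemma wilton_half_uminus:
  shows "wilton_defined (1 / 2) (- x) \<longleftrightarrow> wilton_defined (1 / 2) x" "wilton (1 / 2) (- x) = wilton (1 / 2) x"
  by (intro wilton_cong; simp add: alpha_bar_half cf_fold_half_uminus)+

lemma wilton_half_abs:
  shows "wilton_defined (1 / 2) \<bar>x\<bar> \<longleftrightarrow> wilton_defined (1 / 2) x" "wilton (1 / 2) \<bar>x\<bar> = wilton (1 / 2) x"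
  by (auto simp: abs_if wilton_half_uminus)

text \<open>Being even and 1-periodic, the function for the parameter 1/2 is invariant under every folding,
  whatever the parameter of the folding.\<close>

lemma wilton_half_fold:
  shows "wilton_defined (1 / 2) (cf_fold a x) \<longleftrightarrow> wilton_defined (1 / 2) x"
    "wilton (1 / 2) (cf_fold a x) = wilton (1 / 2) x"
  unfolding cf_fold_def
  using wilton_shift[of "1 / 2" x "- \<lfloor>x + 1 - a\<rfloor>"] by (simp_all add: wilton_half_abs)

lemma wilton_half_reflect:
  shows "wilton_defined (1 / 2) (of_int k - x) \<longleftrightarrow> wilton_defined (1 / 2) x"
    "wilton (1 / 2) (of_int k - x) = wilton (1 / 2) x"
  using wilton_shift[of "1 / 2" "- x" k] by (simp_all add: wilton_half_uminus add.commute)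

lemma wilton_term_half_Suc:
  assumes "0 < x" "x < 1 / 2"
  shows "wilton_term (1 / 2) x (Suc n) = - x * wilton_term (1 / 2) (1 / x) n"
    and "wilton_term (1 / 2) x 0 = - ln x"
proof -
  have "\<lfloor>x + 1 - 1 / 2\<rfloor> = 0" using assms by (simp add: floor_eq_iff)
  then have x: "cf_fold (1 / 2) x = x" using assms by (simp add: cf_fold_def)
  have "cf_map (1 / 2) x = cf_fold (1 / 2) (1 / x)" using assms by (simp add: cf_map_eq_fold)
  then show "wilton_term (1 / 2) x (Suc n) = - x * wilton_term (1 / 2) (1 / x) n"
    by (simp add: wilton_term_def cf_beta_eq cf_orbit_eq alpha_bar_half x cf_prod_Suc_shift funpow_swap1)
  show "wilton_term (1 / 2) x 0 = - ln x"
    using assms by (simp add: wilton_term_def cf_beta_eq cf_orbit_eq cf_prod_def alpha_bar_half x ln_div)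
qed

text \<open>On \<open>(0, 1/2)\<close> the orbit of \<open>1 / x\<close> is the orbit of \<open>x\<close> without its first point.\<close>

lemma wilton_half_inversion:
  assumes "0 < x" "x < 1 / 2"
  shows "wilton_defined (1 / 2) (1 / x) \<longleftrightarrow> wilton_defined (1 / 2) x"
    and "wilton_defined (1 / 2) x \<Longrightarrow> wilton (1 / 2) x = - ln x - x * wilton (1 / 2) (1 / x)"
proof -
  have "1 / x \<in> \<rat> \<longleftrightarrow> x \<in> \<rat>"
    by (metis Rats_divide Rats_1 div_by_1 divide_divide_eq_right mult_1)
  moreover have "summable (wilton_term (1 / 2) (1 / x)) \<longleftrightarrow> summable (wilton_term (1 / 2) x)"
  proof -
    have "summable (wilton_term (1 / 2) x) \<longleftrightarrow> summable (\<lambda>n. - x * wilton_term (1 / 2) (1 / x) n)"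
      using wilton_term_half_Suc(1)[OF assms] summable_Suc_iff[of "wilton_term (1 / 2) x"] by simp
    then show ?thesis using assms by (subst (asm) summable_cmult_iff) auto
  qed
  ultimately show iff: "wilton_defined (1 / 2) (1 / x) \<longleftrightarrow> wilton_defined (1 / 2) x"
    by (simp add: wilton_defined_def)
  assume def: "wilton_defined (1 / 2) x"
  have s: "summable (wilton_term (1 / 2) x)" "summable (wilton_term (1 / 2) (1 / x))"
    using def iff by (auto simp: wilton_defined_def)
  have "wilton (1 / 2) x = wilton_term (1 / 2) x 0 + (\<Sum>n. wilton_term (1 / 2) x (Suc n))"
    using def suminf_split_head[OF s(1)] by (simp add: wilton_def)
  also have "(\<Sum>n. wilton_term (1 / 2) x (Suc n)) = - x * wilton (1 / 2) (1 / x)"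
    unfolding wilton_term_half_Suc(1)[OF assms] suminf_mult[OF s(2)] using def iff by (simp add: wilton_def)
  finally show "wilton (1 / 2) x = - ln x - x * wilton (1 / 2) (1 / x)"
    by (simp add: wilton_term_half_Suc(2)[OF assms])
qed

lemma nn_integral_abs_log_half: "(\<integral>\<^sup>+x\<in>{0..1 / 2}. ennreal \<bar>ln (1 / x)\<bar> \<partial>lborel) < \<infinity>"
proof -
  have "(\<integral>\<^sup>+x\<in>{0..1 / 2 :: real}. ennreal \<bar>ln (1 / x)\<bar> \<partial>lborel) \<le> ennreal (1 / 2) + ennreal (1 / 2)"
  proof (rule nn_integral_Icc_from_zero)
    fix e :: real assume e: "0 < e" "e < 1 / 2"
    have "(\<integral>\<^sup>+x\<in>{e..1 / 2}. ennreal \<bar>ln (1 / x)\<bar> \<partial>lborel)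
       \<le> (\<integral>\<^sup>+x. ennreal (ln ((1 / 2) / x)) * indicator {e..1 / 2} x + ennreal 1 * indicator {e..1 / 2} x \<partial>lborel)"
    proof (rule nn_integral_mono)
      fix x :: real
      show "ennreal \<bar>ln (1 / x)\<bar> * indicator {e..1 / 2} x
        \<le> ennreal (ln ((1 / 2) / x)) * indicator {e..1 / 2} x + ennreal 1 * indicator {e..1 / 2} x"
      proof (cases "x \<in> {e..1 / 2}")
        case True
        then have x: "0 < x" "x \<le> 1 / 2" using e by auto
        have "ln (2 :: real) \<le> 1" using ln_le_minus_one[of 2] by simp
        moreover have "ln ((1 / 2) / x) = ln (1 / x) - ln 2" using x by (simp add: ln_div ln_mult)
        moreover have "0 \<le> ln ((1 / 2) / x)" "0 \<le> ln (1 / x)" using x by (auto intro!: ln_ge_zero)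
        ultimately have "0 \<le> ln ((1 / 2) / x)" "\<bar>ln (1 / x)\<bar> \<le> ln ((1 / 2) / x) + 1" by linarith+
        then have "ennreal \<bar>ln (1 / x)\<bar> \<le> ennreal (ln ((1 / 2) / x)) + ennreal 1"
          by (metis ennreal_leI ennreal_plus zero_le_one)
        then show ?thesis using True by simp
      qed simp
    qed
    also have "\<dots> = (\<integral>\<^sup>+x\<in>{e..1 / 2}. ennreal (ln ((1 / 2) / x)) \<partial>lborel) + (\<integral>\<^sup>+x\<in>{e..1 / 2}. ennreal 1 \<partial>lborel)"
      by (rule nn_integral_add) measurable
    also have "\<dots> \<le> ennreal (1 / 2 - e) + ennreal (1 * (1 / 2 - e))"
      using e by (intro add_mono nn_integral_log_Icc nn_integral_const_Icc[THEN eq_refl]) auto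
    also have "\<dots> \<le> ennreal (1 / 2) + ennreal (1 / 2)"
      using e by (intro add_mono ennreal_leI) auto
    finally show "(\<integral>\<^sup>+x\<in>{e..1 / 2}. ennreal \<bar>ln (1 / x)\<bar> \<partial>lborel) \<le> ennreal (1 / 2) + ennreal (1 / 2)" .
  qed auto
  also have "\<dots> < \<infinity>"
    by (simp only: infinity_ennreal_def ennreal_add_less_top ennreal_less_top simp_thms)
  finally show ?thesis .
qed

lemma AE_irrational: "AE x in lborel. (x :: real) \<notin> \<rat>"
  by (rule AE_not_in[OF countable_imp_null_set_lborel[OF countable_rat]])

lemma AE_summable_wilton_half: "AE x in lborel. summable (\<lambda>n. \<bar>wilton_term (1 / 2) x n\<bar>)"
  using AE_summable_cf_series[of "\<lambda>y. ln (1 / y)" "1 / 2"] nn_integral_abs_log_half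
  by (simp add: alpha_bar_half abs_wilton_term)

lemma AE_wilton_half_defined: "AE x in lborel. wilton_defined (1 / 2) x"
  using AE_irrational AE_summable_wilton_half
  by eventually_elim (auto simp: wilton_defined_def dest: summable_rabs_cancel)

lemma nn_integral_wilton_half_finite: "(\<integral>\<^sup>+x\<in>{0..1}. ennreal \<bar>wilton (1 / 2) x\<bar> \<partial>lborel) < \<infinity>"
proof -
  have "(\<integral>\<^sup>+x\<in>{0..1}. ennreal \<bar>wilton (1 / 2) x\<bar> \<partial>lborel)
      \<le> (\<integral>\<^sup>+x\<in>{0..1}. (\<Sum>n. ennreal \<bar>wilton_term (1 / 2) x n\<bar>) \<partial>lborel)"
  proof (rule nn_integral_mono_AE, use AE_summable_wilton_half in eventually_elim)
    case (elim x)
    have "\<bar>wilton (1 / 2) x\<bar> \<le> (\<Sum>n. \<bar>wilton_term (1 / 2) x n\<bar>)"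
      using summable_rabs[OF elim] suminf_nonneg[OF elim] by (auto simp: wilton_def)
    then have "ennreal \<bar>wilton (1 / 2) x\<bar> \<le> (\<Sum>n. ennreal \<bar>wilton_term (1 / 2) x n\<bar>)"
      using elim by (subst suminf_ennreal2) (auto intro!: ennreal_leI)
    then show ?case by (intro mult_right_mono) auto
  qed
  also have "\<dots> < \<infinity>"
    using nn_integral_cf_series_finite[of "\<lambda>y. ln (1 / y)" "1 / 2"] nn_integral_abs_log_half
    by (simp add: alpha_bar_half abs_wilton_term)
  finally show ?thesis .
qed

proposition wilton_half_osc_le:
  "\<exists>K\<ge>0. \<forall>a b. a < b \<longrightarrow> osc_le (wilton (1 / 2)) K a b"
proof -
  obtain L where L: "0 \<le> L" "(\<integral>\<^sup>+x\<in>{0..1}. ennreal \<bar>wilton (1 / 2) x\<bar> \<partial>lborel) = ennreal L"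
    using nn_integral_wilton_half_finite by (auto simp: less_top_ennreal)
  interpret log_inversion "wilton (1 / 2)" L
  proof
    show "AE x in lborel. 0 < x \<and> x < 1 / 2 \<longrightarrow> wilton (1 / 2) x = - ln x - x * wilton (1 / 2) (1 / x)"
      using AE_wilton_half_defined by eventually_elim (auto intro: wilton_half_inversion)
  qed (use L in \<open>simp_all add: wilton_shift wilton_half_uminus\<close>)
  show ?thesis using L osc_le_all by (intro exI[of _ "6 + 20 * L"]) simp
qed

section \<open>Comparison of the parameters\<close>

text \<open>The defect of the functional equation of the function for the parameter 1/2.  It vanishes on
  \<open>(0, 1/2)\<close> and is bounded up to the golden section.\<close>

definition wilton_defect :: "real \<Rightarrow> real" where
  "wilton_defect x = wilton (1 / 2) x + ln x + x * wilton (1 / 2) (1 / x)"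

text \<open>For \<open>x\<close> beyond 1/2, the value at \<open>x\<close> is that at \<open>1 - x\<close>, and two inversions lead from there through
  \<open>y = (2 x - 1) / (1 - x)\<close> to \<open>1 / y\<close>, up to translation; one inversion leads to \<open>1 / y\<close> from \<open>1 / x\<close>.
  The values at \<open>1 / y\<close> enter \<open>W(x)\<close> and \<open>- x W(1/x)\<close> with the same sign and the same
  weight \<open>2 x - 1\<close>, and so cancel in the defect.\<close>

lemma wilton_defect_step:
  assumes x: "1 / 2 < x" "x < 2 / 3" and D: "wilton_defined (1 / 2) x"
    and y: "y = (2 * x - 1) / (1 - x)" and Dy: "wilton_defined (1 / 2) (1 / y)"
  shows "wilton_defined (1 / 2) (1 / x)" "\<bar>wilton_defect x\<bar> \<le> 6 + \<bar>wilton_defect y\<bar> / 2"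
proof -
  let ?W = "wilton (1 / 2)" and ?D = "wilton_defined (1 / 2)"
  define w where "w = (2 * x - 1) / x"
  have w: "0 < w" "w < 1 / 2" using x by (auto simp: w_def field_simps)
  have y0: "0 < y" using x by (simp add: y)
  have "?D (1 - x)" using D wilton_half_reflect(1)[of 1 x] by simp
  then have W1: "?W (1 - x) = - ln (1 - x) - (1 - x) * ?W (1 / (1 - x))"
    using x by (intro wilton_half_inversion) auto
  have "1 / (1 - x) = y + of_int 2" using x by (simp add: y field_simps)
  then have "?W (1 / (1 - x)) = ?W y" by (simp only: wilton_shift)
  then have Wx: "?W x = - ln (1 - x) - (1 - x) * ?W y"
    using W1 wilton_half_reflect(2)[of 1 x] by simp
  have w_inv: "1 / w = 1 / y + of_int 1" using x by (simp add: w_def y field_simps)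
  have "?D (1 / w)" unfolding w_inv wilton_shift by (rule Dy)
  then have Dw: "?D w" using wilton_half_inversion(1)[OF w] by simp
  have x_inv: "1 / x = of_int 2 - w" using x by (simp add: w_def field_simps)
  show "?D (1 / x)" unfolding x_inv wilton_half_reflect by (rule Dw)
  have "?W (1 / w) = ?W (1 / y)" unfolding w_inv by (rule wilton_shift)
  then have "?W (1 / x) = - ln w - w * ?W (1 / y)"
    unfolding x_inv wilton_half_reflect using wilton_half_inversion(2)[OF w Dw] by simp
  then have "wilton_defect x = - ln (1 - x) - (1 - x) * ?W y + ln x + x * (- ln w - w * ?W (1 / y))"
    unfolding wilton_defect_def Wx by simp
  also have "\<dots> = - ln (1 - x) - (1 - x) * wilton_defect y + (1 - x) * ln y + ln x - x * ln w
      + ((1 - x) * y - x * w) * ?W (1 / y)"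
    unfolding wilton_defect_def by (simp add: algebra_simps)
  also have "(1 - x) * y - x * w = 0" using x by (simp add: y w_def)
  also have "ln y = ln (2 * x - 1) - ln (1 - x)" using x by (simp add: y ln_div)
  also have "ln w = ln (2 * x - 1) - ln x" using x by (simp add: w_def ln_div)
  finally have eq: "wilton_defect x = (2 - x) * (- ln (1 - x)) + (1 + x) * ln x
      + (2 * x - 1) * (- ln (2 * x - 1)) - (1 - x) * wilton_defect y"
    by (simp add: algebra_simps)
  have neg_ln: "- ln t \<le> 1 / t - 1" "0 \<le> - ln t" if "0 < t" "t \<le> 1" for t :: real
    using ln_le_minus_one[of "1 / t"] that by (auto simp: ln_div)
  have b1: "0 \<le> (2 - x) * (- ln (1 - x))" "(2 - x) * (- ln (1 - x)) \<le> 3 / 2 * 2"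
  proof -
    have "1 / (1 - x) \<le> 3" using x by (simp add: field_simps)
    then have "- ln (1 - x) \<le> 2" using neg_ln(1)[of "1 - x"] x by simp
    then show "(2 - x) * (- ln (1 - x)) \<le> 3 / 2 * 2"
      using neg_ln(2)[of "1 - x"] x by (intro mult_mono) auto
    show "0 \<le> (2 - x) * (- ln (1 - x))"
      using neg_ln(2)[of "1 - x"] x by (intro mult_nonneg_nonneg) auto
  qed
  have b2: "0 \<le> (1 + x) * (- ln x)" "(1 + x) * (- ln x) \<le> 2 * 1"
  proof -
    have "1 / x \<le> 2" using x by (simp add: field_simps)
    then have "- ln x \<le> 1" using neg_ln(1)[of x] x by simp
    then show "(1 + x) * (- ln x) \<le> 2 * 1"
      using neg_ln(2)[of x] x by (intro mult_mono) auto
    show "0 \<le> (1 + x) * (- ln x)"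
      using neg_ln(2)[of x] x by (intro mult_nonneg_nonneg) auto
  qed
  have b3: "0 \<le> (2 * x - 1) * (- ln (2 * x - 1))" "(2 * x - 1) * (- ln (2 * x - 1)) \<le> 1"
  proof -
    have "(2 * x - 1) * (- ln (2 * x - 1)) \<le> (2 * x - 1) * (1 / (2 * x - 1) - 1)"
      using neg_ln(1)[of "2 * x - 1"] x by (intro mult_left_mono) auto
    also have "\<dots> = 1 - (2 * x - 1)" using x by (simp add: field_simps)
    finally show "(2 * x - 1) * (- ln (2 * x - 1)) \<le> 1" using x by simp
    show "0 \<le> (2 * x - 1) * (- ln (2 * x - 1))"
      using neg_ln(2)[of "2 * x - 1"] x by (intro mult_nonneg_nonneg) auto
  qed
  have "\<bar>(1 - x) * wilton_defect y\<bar> \<le> 1 / 2 * \<bar>wilton_defect y\<bar>"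
    unfolding abs_mult using x by (intro mult_right_mono) auto
  then show "\<bar>wilton_defect x\<bar> \<le> 6 + \<bar>wilton_defect y\<bar> / 2"
    unfolding eq using b1 b2 b3 by (simp add: abs_le_iff) linarith
qed

lemma golden_section_le: "(sqrt 5 - 1) / 2 \<le> (5 / 8 :: real)"
proof -
  have "sqrt 5 < sqrt ((9 / 4)\<^sup>2)" by (intro real_sqrt_less_mono) (simp add: power2_eq_square)
  then show ?thesis by simp
qed

text \<open>The map \<open>x \<mapsto> y\<close> of the preceding lemma fixes the golden section and expands at it by a factor of
  at least 2.  So the points \<open>y\<close> leave \<open>(1/2, g)\<close> after finitely many steps, and the factor 1/2
  of the step bounds the defect.\<close>

lemma wilton_defect_bounded:
  assumes g: "g = (sqrt 5 - 1) / 2" and x: "0 < x" "x \<le> g" and D: "wilton_defined (1 / 2) x"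
  shows "wilton_defined (1 / 2) (1 / x)" "\<bar>wilton_defect x\<bar> \<le> 12"
proof -
  let ?D = "wilton_defined (1 / 2)"
  have "sqrt (2\<^sup>2) < sqrt 5" by (intro real_sqrt_less_mono) simp
  then have g_lt: "g < 2 / 3" "1 / 2 < g" using golden_section_le by (simp_all add: g)
  have g2: "g * g = 1 - g" by (simp add: g field_simps)
  have g_inv: "1 / g = g + of_int 1" using g2 g_lt by (simp add: field_simps)
  have low: "?D (1 / x) \<and> \<bar>wilton_defect x\<bar> \<le> 12" if "0 < x" "x < 1 / 2" "?D x" for x
    using wilton_half_inversion[OF that(1,2)] that(3) by (simp add: wilton_defect_def)
  have high: "?D (1 / x) \<and> \<bar>wilton_defect x\<bar> \<le> 12"
    if "1 / 2 < x" "x < g" "?D x" "1 \<le> (g - x) * 2^n" for x n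
    using that
  proof (induction n arbitrary: x)
    case 0
    then show ?case using g_lt by simp
  next
    case (Suc n)
    define y where "y = (2 * x - 1) / (1 - x)"
    have y_eq: "1 / (1 - x) = y + of_int 2" using Suc.prems g_lt by (simp add: y_def field_simps)
    have "?D (1 - x)" using Suc.prems wilton_half_reflect(1)[of 1 x] by simp
    then have "?D (1 / (1 - x))" using Suc.prems g_lt by (subst wilton_half_inversion) auto
    then have Dy: "?D y" unfolding y_eq wilton_shift .
    have y0: "0 < y" using Suc.prems g_lt by (simp add: y_def)
    have "1 / (1 - g) = g + 2" using g2 g_lt by (simp add: field_simps)
    then have "g - y = 1 / (1 - g) - 1 / (1 - x)" using y_eq by simp
    also have "\<dots> = (g - x) / ((1 - g) * (1 - x))" using Suc.prems g_lt by (simp add: field_simps)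
    also have "\<dots> \<ge> (g - x) / (1 / 2)"
    proof (intro divide_left_mono mult_pos_pos)
      have "(1 - g) * (1 - x) \<le> 1 / 2 * 1" using Suc.prems g_lt by (intro mult_mono) auto
      then show "(1 - g) * (1 - x) \<le> 1 / 2" by simp
    qed (use Suc.prems g_lt in auto)
    finally have gy: "2 * (g - x) \<le> g - y" by simp
    have "?D (1 / y) \<and> \<bar>wilton_defect y\<bar> \<le> 12"
    proof (cases "1 / 2 < y")
      case True
      have "(g - x) * 2^Suc n = (2 * (g - x)) * 2^n" by simp
      also have "\<dots> \<le> (g - y) * 2^n" using gy by (intro mult_right_mono) auto
      finally have "1 \<le> (g - y) * 2^n" using Suc.prems(4) by linarith
      then show ?thesis using True gy Suc.prems Dy by (intro Suc.IH) auto
    next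
      case False
      have "(1 / 2 :: real) \<in> \<rat>" by simp
      then have "y \<noteq> 1 / 2" using Dy wilton_defined_irrational by blast
      then show ?thesis using False y0 Dy by (intro low) auto
    qed
    moreover have "x < 2 / 3" using Suc.prems g_lt by linarith
    ultimately show ?case
      using wilton_defect_step[OF Suc.prems(1) _ Suc.prems(3) y_def] by auto
  qed
  have "?D (1 / x) \<and> \<bar>wilton_defect x\<bar> \<le> 12"
  proof -
    have "(1 / 2 :: real) \<in> \<rat>" by simp
    then have "x \<noteq> 1 / 2" using D wilton_defined_irrational by blast
    then consider "x < 1 / 2" | "x = g" | "1 / 2 < x" "x < g" using x by linarith
    then show ?thesis
    proof cases
      case 1
      then show ?thesis using low x D by blast
    next
      case 2
      \<comment> \<open>The step maps \<open>g\<close> to itself, so its inequality bounds the defect at \<open>g\<close> by itself.\<close>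
      then have Dg: "?D (1 / g)" unfolding g_inv wilton_shift using D by simp
      have "g = (2 * g - 1) / (1 - g)" using g2 g_lt by (simp add: field_simps)
      from wilton_defect_step(2)[OF g_lt(2,1) _ this Dg] have "\<bar>wilton_defect g\<bar> \<le> 6 + \<bar>wilton_defect g\<bar> / 2"
        using D 2 by simp
      then show ?thesis using Dg 2 by simp
    next
      case 3
      obtain n where "1 / (g - x) < 2^n" using real_arch_pow[of 2 "1 / (g - x)"] by auto
      then have "1 \<le> (g - x) * 2^n" using 3 by (simp add: field_simps)
      then show ?thesis using high 3 D by blast
    qed
  qed
  then show "?D (1 / x)" "\<bar>wilton_defect x\<bar> \<le> 12" by auto
qed

text \<open>Along the orbit of \<open>x\<close> for the parameter \<open>\<alpha>\<close>, the function for the parameter 1/2 satisfies its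
  functional equation up to the bounded defect.  Iterating it produces the series for \<open>\<alpha>\<close>, an
  absolutely convergent series of defects and a remainder, which tends to 0 under the summability
  assumption.\<close>

proposition wilton_minus_wilton_half_bounded:
  assumes g: "g = (sqrt 5 - 1) / 2" and \<alpha>: "\<alpha> \<in> {1 - g..g}"
    and D: "wilton_defined (1 / 2) x"
    and rem: "summable (\<lambda>n. cf_beta \<alpha> x n * \<bar>wilton (1 / 2) (cf_orbit \<alpha> x n)\<bar>)"
  shows "wilton_defined \<alpha> x" "\<bar>wilton \<alpha> x - wilton (1 / 2) x\<bar> \<le> 32"
proof -
  let ?W = "wilton (1 / 2)" and ?D = "wilton_defined (1 / 2)"
  let ?x = "cf_orbit \<alpha> x" and ?\<beta> = "cf_beta \<alpha> x"
  have g58: "g \<le> 5 / 8" using golden_section_le by (simp add: g)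
  have \<alpha>01: "0 \<le> \<alpha>" "\<alpha> \<le> 1" using \<alpha> g58 by auto
  have bar: "alpha_bar \<alpha> \<le> g" using \<alpha> by (auto simp: alpha_bar_def)
  have le: "?x n \<le> g" for n using cf_orbit_bounds(2)[OF \<alpha>01, of x n] bar by linarith
  have pos: "0 < ?x n" if "?D (?x n)" for n
    using cf_orbit_bounds(1)[OF \<alpha>01, of x n] wilton_defined_irrational[OF that]
    by (cases "?x n = 0") auto
  have Suc_eq: "?x (Suc n) = cf_fold \<alpha> (1 / ?x n)" if "?D (?x n)" for n
    using pos[OF that] by (simp add: cf_orbit_eq cf_map_eq_fold)
  have Dn: "?D (?x n)" for n
  proof (induction n)
    case 0
    then show ?case using D by (simp add: cf_orbit_eq wilton_half_fold)
  next
    case (Suc n)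
    show ?case unfolding Suc_eq[OF Suc] wilton_half_fold
      by (rule wilton_defect_bounded(1)[OF g pos[OF Suc] le Suc])
  qed
  have defect: "\<bar>wilton_defect (?x n)\<bar> \<le> 12" for n
    by (rule wilton_defect_bounded(2)[OF g pos[OF Dn] le Dn])
  have W_Suc: "?W (?x (Suc n)) = ?W (1 / ?x n)" for n
    unfolding Suc_eq[OF Dn] by (rule wilton_half_fold)
  define e where "e n = (- 1)^n * ?\<beta> n * wilton_defect (?x n)" for n
  \<comment> \<open>The functional equation, iterated \<open>n\<close> times.\<close>
  have ident: "(\<Sum>j<n. wilton_term \<alpha> x j) = ?W x - (\<Sum>j<n. e j) - (- 1)^n * ?\<beta> n * ?W (?x n)" for n
  proof (induction n)
    case 0
    show ?case by (simp add: cf_beta_def cf_orbit_eq wilton_half_fold)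
  next
    case (Suc n)
    have \<beta>: "?\<beta> (Suc n) = ?\<beta> n * ?x n" by (simp add: cf_beta_def)
    have "wilton_term \<alpha> x n = (- 1)^n * ?\<beta> n * (- ln (?x n))"
      using pos[OF Dn, of n] by (simp add: wilton_term_def ln_div)
    moreover have "- ln (?x n) = ?W (?x n) - wilton_defect (?x n) + ?x n * ?W (?x (Suc n))"
      unfolding W_Suc wilton_defect_def by simp
    ultimately have "wilton_term \<alpha> x n = (- 1)^n * ?\<beta> n * ?W (?x n) - e n - (- 1)^Suc n * ?\<beta> (Suc n) * ?W (?x (Suc n))"
      unfolding e_def \<beta> by (simp add: algebra_simps)
    then show ?case using Suc by simp
  qed
  have \<beta>0: "0 \<le> ?\<beta> n" for n by (rule cf_beta_nonneg[OF \<alpha>01])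
  have \<beta>_le: "?\<beta> n \<le> (5 / 8)^n" for n
  proof (induction n)
    case (Suc n)
    have "?\<beta> n * ?x n \<le> (5 / 8)^n * (5 / 8)"
      using Suc le[of n] g58 cf_orbit_bounds(1)[OF \<alpha>01, of x n] by (intro mult_mono) auto
    then show ?case by (simp add: cf_beta_def mult.commute)
  qed (simp add: cf_beta_def)
  have e_le: "\<bar>e n\<bar> \<le> (5 / 8)^n * 12" for n
    unfolding e_def abs_mult using \<beta>_le[of n] \<beta>0[of n] defect[of n]
    by (auto simp: power_abs intro!: mult_mono)
  have geo: "(\<lambda>n. (5 / 8)^n * 12 :: real) sums 32"
    using sums_mult2[OF geometric_sums[of "5 / 8 :: real"], of 12] by simp
  have e_abs: "summable (\<lambda>n. \<bar>e n\<bar>)"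
    by (rule summable_comparison_test[OF _ sums_summable[OF geo]]) (use e_le in auto)
  have "(\<lambda>n. \<bar>(- 1)^n * ?\<beta> n * ?W (?x n)\<bar>) \<longlonglongrightarrow> 0"
    using summable_LIMSEQ_zero[OF rem] \<beta>0 by (simp add: abs_mult power_abs)
  then have rem0: "(\<lambda>n. (- 1)^n * ?\<beta> n * ?W (?x n)) \<longlonglongrightarrow> 0"
    by (rule tendsto_rabs_zero_cancel)
  have "(\<lambda>n. \<Sum>j<n. wilton_term \<alpha> x j) \<longlonglongrightarrow> ?W x - (\<Sum>n. e n) - 0"
    unfolding ident
    by (intro tendsto_diff tendsto_const rem0 summable_LIMSEQ summable_rabs_cancel[OF e_abs])
  then have sums: "wilton_term \<alpha> x sums (?W x - (\<Sum>n. e n))" by (simp add: sums_def)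
  show def: "wilton_defined \<alpha> x"
    using sums wilton_defined_irrational[OF D] by (auto simp: wilton_defined_def sums_iff)
  have "\<bar>wilton \<alpha> x - ?W x\<bar> = \<bar>\<Sum>n. e n\<bar>"
    using def sums by (simp add: wilton_def sums_iff)
  also have "\<dots> \<le> (\<Sum>n. \<bar>e n\<bar>)" by (rule summable_rabs[OF e_abs])
  also have "\<dots> \<le> (\<Sum>n. (5 / 8)^n * 12)"
    by (rule suminf_le[OF e_le e_abs sums_summable[OF geo]])
  also have "\<dots> = 32" using geo by (simp add: sums_iff)
  finally show "\<bar>wilton \<alpha> x - ?W x\<bar> \<le> 32" .
qed

theorem theorem1p1:
  fixes g \<alpha> :: real
  assumes "g = (sqrt 5 - 1) / 2"
    and "\<alpha> \<in> {1 - g..g}"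
  shows "(AE x in lebesgue. wilton_defined \<alpha> x) \<and> wilton \<alpha> \<in> BMO"
proof -
  have "g \<le> 5 / 8" using golden_section_le by (simp add: assms(1))
  then have \<alpha>: "0 \<le> \<alpha>" "\<alpha> \<le> 1" "alpha_bar \<alpha> \<le> 5 / 8" using assms(2) by (auto simp: alpha_bar_def max_def)
  have "(\<integral>\<^sup>+x\<in>{0..alpha_bar \<alpha>}. ennreal \<bar>wilton (1 / 2) x\<bar> \<partial>lborel)
      \<le> (\<integral>\<^sup>+x\<in>{0..1}. ennreal \<bar>wilton (1 / 2) x\<bar> \<partial>lborel)"
    using \<alpha> by (intro nn_integral_mono_set) auto
  also have "\<dots> < \<infinity>" by (rule nn_integral_wilton_half_finite)
  finally have "AE x in lborel. summable (\<lambda>n. cf_beta \<alpha> x n * \<bar>wilton (1 / 2) (cf_orbit \<alpha> x n)\<bar>)"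
    using \<alpha> by (intro AE_summable_cf_series) auto
  with AE_wilton_half_defined
  have ae: "AE x in lborel. wilton_defined \<alpha> x \<and> \<bar>wilton \<alpha> x - wilton (1 / 2) x\<bar> \<le> 32"
    by eventually_elim (use wilton_minus_wilton_half_bounded[OF assms] in blast)
  obtain K where K: "0 \<le> K" "\<And>a b. a < b \<Longrightarrow> osc_le (wilton (1 / 2)) K a b"
    using wilton_half_osc_le by blast
  have "osc_le (wilton \<alpha>) (K + 32) a b" if "a < b" for a b
    by (rule osc_le_perturb[where h = "wilton (1 / 2)"]) (use ae K that in auto)
  then have "wilton \<alpha> \<in> BMO" using K by (intro BMO_if_osc_le[of _ "K + 32"]) auto
  moreover have "AE x in lebesgue. wilton_defined \<alpha> x"
    using ae by (intro AE_completion) auto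
  ultimately show ?thesis by blast
qed

end
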